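(* Let $q \ge 1$ be an odd integer and let $a$ and $b$ be admissible residue classes modulo $q$. Let $r \ge 1$, and let $\mathbf a = [a_1, \dots, a_r]$ be an $r$-tuple of residue classes modulo $q$ such that for some $1 \le j \le r$ we have $a_i = a$ whenever $i \le j$ and $a_i = b$ whenever $i > j$. Then $N(x;q,\mathbf a) \to \infty$ as $x \to \infty$.
   Context: Let $\mathbf E = \{m^2 + l^2 : m,l \text{ nonnegative integers}\}$ be the set of sums of two squares, and let $E_1 < E_2 < E_3 < \cdots$ be its elements listed in increasing order. A residue class $a$ modulo $q$ is called admissible if the congruence $x^2 + y^2 \equiv a \pmod q$ has a solution in integers $x,y$. For a modulus $q$, an integer $r \ge 1$ and an $r$-tuple $\mathbf a = [a_1,\dots,a_r]$ of admissible residue classes modulo $q$, define $N(x;q,\mathbf a) := \#\{E_n \le x : E_{n+i-1} \equiv a_i \pmod q \text{ for all } 1 \le i \le r\}$. *)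

theory Defs
  imports Complex_Main "HOL-Library.Infinite_Set" "HOL-Number_Theory.Cong"
begin

definition sums_two_squares :: "nat set" where
  "sums_two_squares = {m\<^sup>2 + l\<^sup>2 | m l. True}"

text \<open>\<open>E_seq 1 < E_seq 2 < \<dots>\<close> lists the sums of two squares in increasing order, starting
  with \<open>E_seq 1 = 0\<close>. Indices start at 1 (\<^const>\<open>enumerate\<close> counts from 0); the value
  \<open>E_seq 0\<close> is a dummy and is never used.\<close>

definition E_seq :: "nat \<Rightarrow> nat" where
  "E_seq n = enumerate sums_two_squares (n - 1)"

text \<open>A residue class modulo \<open>q\<close> is given by an integer representative.\<close>

definition admissible :: "nat \<Rightarrow> int \<Rightarrow> bool" where
  "admissible q a \<longleftrightarrow> (\<exists>x y :: int. [x\<^sup>2 + y\<^sup>2 = a] (mod int q))"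

text \<open>The tuple \<open>[a\<^sub>1, \<dots>, a\<^sub>r]\<close> is the list \<open>as\<close>, so \<open>r = length as\<close> and
  \<open>a\<^sub>i = as ! (i - 1)\<close>.\<close>

definition N_count :: "real \<Rightarrow> nat \<Rightarrow> int list \<Rightarrow> nat" where
  "N_count x q as = card {E_seq n | n. n \<ge> 1 \<and> real (E_seq n) \<le> x \<and>
     (\<forall>i\<in>{1..length as}. [int (E_seq (n + i - 1)) = as ! (i - 1)] (mod int q))}"

lemma infinite_sums_two_squares: "infinite sums_two_squares"
proof -
  have "inj (\<lambda>m::nat. m\<^sup>2)"
    by (rule injI) simp
  then have "infinite (range (\<lambda>m::nat. m\<^sup>2))"
    by (rule range_inj_infinite)
  moreover have "range (\<lambda>m::nat. m\<^sup>2) \<subseteq> sums_two_squares"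
    unfolding sums_two_squares_def by (force intro: exI[of _ "0::nat"])
  ultimately show ?thesis
    by (rule infinite_super[rotated])
qed

lemma E_seq_strict_mono: "1 \<le> m \<Longrightarrow> m < n \<Longrightarrow> E_seq m < E_seq n"
  unfolding E_seq_def
  by (intro enumerate_mono infinite_sums_two_squares) simp

lemma range_E_seq: "E_seq ` {1..} = sums_two_squares"
proof -
  have "(\<lambda>n. n - 1) ` {1::nat..} = UNIV"
    by (auto intro!: image_eqI[of _ _ "Suc _"])
  then have "E_seq ` {1..} = range (enumerate sums_two_squares)"
    unfolding E_seq_def by (metis image_image)
  then show ?thesis
    by (simp add: range_enumerate infinite_sums_two_squares)
qed

text \<open>The set counted by \<^const>\<open>N_count\<close> is finite, so \<^const>\<open>card\<close> is its true size.\<close>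

lemma finite_N_count_set:
  "finite {E_seq n | n. n \<ge> 1 \<and> real (E_seq n) \<le> x \<and> P n}"
  by (rule finite_subset[of _ "{..nat \<lfloor>x\<rfloor>}"]) (auto simp: le_nat_floor)

end

theory Submission
  imports Defs "HOL-Number_Theory.Number_Theory" "HOL-Analysis.Analysis" "HOL-Computational_Algebra.Squarefree"
begin

text \<open>Fix \<open>D = M \<cdot> \<Prod>S\<close>, where \<open>S\<close> is a set of large primes that are 1 mod 4 and \<open>M\<close> is a sum of two
  squares, and consider the values \<open>(T\<^sup>2 + s\<^sup>2) / D\<close> for one large \<open>T\<close> and for \<open>s\<close> in
  \<open>[s\<^sub>0, s\<^sub>0 + \<Prod>S)\<close>. By the Chinese remainder theorem there are small offsets \<open>E\<^sub>p\<close>, \<open>p \<in> S\<close>, divisible by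
  all primes of \<open>S\<close> except \<open>p\<close>, such that \<open>T\<close> and \<open>s\<^sub>0\<close> can be arranged so that these values are
  integers exactly when \<open>s - s\<^sub>0\<close> is a subset sum of the \<open>E\<^sub>p\<close>; they are then sums of two squares. All
  \<open>E\<^sub>p\<close> are divisible by \<open>q\<close>, except for one \<open>E\<^sub>r\<close> that exceeds the sum of the others and shifts the
  residue class from \<open>a\<close> to \<open>b\<close>. So the window contains many such values in the class \<open>a\<close>, followed by
  many in the class \<open>b\<close>.

  Any other integer \<open>n\<close> of the window has \<open>D n = T\<^sup>2 + \<Delta>\<close> with a nonsquare \<open>\<Delta> > 0\<close> from a finite set that
  does not depend on \<open>T\<close>. Hence \<open>T\<close> can be restricted to a progression in which each of these \<open>n\<close> is exactly
  divisible by a prime that is 3 mod 4. The primes needed here, those that are 3 mod 4 and have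
  \<open>-\<Delta>\<close> as a quadratic residue, are produced by comparing Euler products over the primes split by
  \<open>\<Delta>\<close> and by \<open>-1\<close> with \<open>\<zeta>(s)\<close> as \<open>s \<rightarrow> 1\<close>.\<close>

section \<open>Sums of two squares and quadratic residues\<close>

lemma Legendre_cases:
  assumes "\<not> int p dvd a"
  shows "Legendre a (int p) = (if QuadRes (int p) a then 1 else -1)"
  using assms by (auto simp: Legendre_def cong_0_iff)

text \<open>Euler's criterion makes the Legendre symbol multiplicative modulo \<open>p\<close>. All
  symbols here are 1 or -1, and the congruence becomes an equality because \<open>p > 2\<close>
  divides neither 2 nor -2.\<close>

lemma QuadRes_mult_iff:
  assumes p: "prime p" "2 < p" and a: "\<not> int p dvd a" and b: "\<not> int p dvd b"
  shows "QuadRes (int p) (a * b) \<longleftrightarrow> (QuadRes (int p) a \<longleftrightarrow> QuadRes (int p) b)"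
proof -
  let ?L = "\<lambda>x. Legendre x (int p)"
  have ab: "\<not> int p dvd a * b"
    using a b p(1) by (simp add: prime_dvd_mult_iff)
  have "[?L (a * b) = a ^ ((p - 1) div 2) * b ^ ((p - 1) div 2)] (mod int p)"
    using euler_criterion[OF p, of "a * b"] by (simp add: power_mult_distrib)
  moreover have "[?L a * ?L b = a ^ ((p - 1) div 2) * b ^ ((p - 1) div 2)] (mod int p)"
    by (intro cong_mult euler_criterion p)
  ultimately have "[?L (a * b) = ?L a * ?L b] (mod int p)"
    using cong_sym cong_trans by blast
  then have d: "int p dvd ?L (a * b) - ?L a * ?L b"
    by (simp add: cong_iff_dvd_diff)
  have "\<not> int p dvd 2" "\<not> int p dvd -2"
    using p by (auto dest: zdvd_imp_le)
  then show ?thesis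
    using d unfolding Legendre_cases[OF a] Legendre_cases[OF b] Legendre_cases[OF ab]
    by (auto split: if_splits)
qed

text \<open>By Euler's criterion only the parity of \<open>(p - 1) div 2\<close> matters.\<close>

lemma QuadRes_minus_one_iff:
  assumes p: "prime p" "2 < p"
  shows "QuadRes (int p) (-1) \<longleftrightarrow> p mod 4 = 1"
proof -
  have odd: "odd p" using p by (simp add: prime_odd_nat)
  have nd: "\<not> int p dvd -1" using p by auto
  have n2: "\<not> int p dvd 2" "\<not> int p dvd -2"
    using p by (auto dest: zdvd_imp_le)
  have "p mod 4 = 1 \<or> p mod 4 = 3" using odd by presburger
  then consider "p mod 4 = 1" "even ((p - 1) div 2)" | "p mod 4 = 3" "odd ((p - 1) div 2)"
  proof
    assume "p mod 4 = 1"
    then have "even ((p - 1) div 2)" by presburger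
    then show ?thesis using that \<open>p mod 4 = 1\<close> by blast
  next
    assume "p mod 4 = 3"
    then have "odd ((p - 1) div 2)" by presburger
    then show ?thesis using that \<open>p mod 4 = 3\<close> by blast
  qed
  then show ?thesis
  proof cases
    case 1
    then show ?thesis
      using euler_criterion[OF p, of "-1"] n2
      by (auto simp: Legendre_cases[OF nd] cong_iff_dvd_diff split: if_splits)
  next
    case 2
    then show ?thesis
      using euler_criterion[OF p, of "-1"] n2
      by (auto simp: Legendre_cases[OF nd] cong_iff_dvd_diff split: if_splits)
  qed
qed

text \<open>Since \<open>y\<close> is invertible modulo \<open>p\<close>, the quotient of
  \<open>x\<close> by \<open>y\<close> is a square root of \<open>c\<close>.\<close>

lemma QuadRes_quotient:
  assumes p: "prime p" and d: "int p dvd x\<^sup>2 - c * y\<^sup>2" and y: "\<not> int p dvd y"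
  shows "QuadRes (int p) c"
proof -
  have "coprime y (int p)"
    using p y by (metis coprime_commute prime_imp_coprime_int prime_nat_int_transfer)
  then obtain w where "[y * w = 1] (mod int p)"
    using cong_solve_coprime_int by blast
  then have "[y\<^sup>2 * w\<^sup>2 = 1] (mod int p)"
    using cong_pow[of "y * w" 1 "int p" 2] by (simp add: power_mult_distrib)
  then have "[c * (y\<^sup>2 * w\<^sup>2) = c * 1] (mod int p)"
    by (rule cong_scalar_left)
  moreover have "[x\<^sup>2 * w\<^sup>2 = c * y\<^sup>2 * w\<^sup>2] (mod int p)"
    using d by (intro cong_scalar_right) (simp add: cong_iff_dvd_diff)
  ultimately have "[(x * w)\<^sup>2 = c] (mod int p)"
    by (simp add: power_mult_distrib mult.assoc) (meson cong_trans)
  then show ?thesis unfolding QuadRes_def by blast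
qed

text \<open>If \<open>p\<close> did not divide \<open>y\<close>, the quotient of \<open>x\<close> by
  \<open>y\<close> would be a square root of -1 modulo \<open>p\<close>.\<close>

lemma prime_3_mod_4_dvd_sum_squares:
  assumes p: "prime p" "p mod 4 = 3" and d: "int p dvd x\<^sup>2 + y\<^sup>2"
  shows "int p dvd x \<and> int p dvd y"
proof -
  have p2: "2 < p" using p prime_ge_2_nat[of p] by (cases "p = 2") auto
  have "\<not> QuadRes (int p) (-1)"
    using QuadRes_minus_one_iff[OF p(1) p2] p(2) by simp
  then have y: "int p dvd y"
    using QuadRes_quotient[OF p(1), of x "-1" y] d by auto
  then have "int p dvd x\<^sup>2"
    using d by (metis dvd_add_left_iff dvd_power zero_less_numeral dvd_trans)
  then show ?thesis
    using y p(1) prime_dvd_power_int[of "int p" x 2] by simp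
qed

lemma prime_not_dvd_twice:
  assumes "prime p" "2 < p" "\<not> int p dvd z"
  shows "\<not> int p dvd 2 * z"
  using assms by (auto simp: prime_dvd_mult_iff dest: zdvd_imp_le)

section \<open>Thue's lemma and sums of two squares\<close>

text \<open>Pigeonhole: more than \<open>n\<close> pairs have both entries between 0 and
  \<open>floor_sqrt n\<close>, so \<open>x - z * y\<close> takes the same residue at two of them,
  and their difference is the required pair.\<close>

lemma thue:
  fixes n :: nat and z :: int
  assumes n: "n > 0"
  shows "\<exists>x y :: int. (x, y) \<noteq> (0, 0) \<and> x\<^sup>2 \<le> int n \<and> y\<^sup>2 \<le> int n \<and> int n dvd x - z * y"
proof -
  define k where "k = floor_sqrt n"
  have k1: "k\<^sup>2 \<le> n" "n < (k + 1)\<^sup>2"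
    using Suc_floor_sqrt_power2_gt[of n] by (simp_all add: k_def)
  define B where "B = {0..int k} \<times> {0..int k}"
  define f where "f = (\<lambda>(x, y). (x - z * y) mod int n)"
  have "f ` B \<subseteq> {0..<int n}"
    using n by (auto simp: f_def)
  then have "card (f ` B) \<le> n"
    using card_mono[of "{0..<int n}"] by fastforce
  moreover have "card B = (k + 1)\<^sup>2"
    by (simp add: B_def power2_eq_square nat_add_distrib)
  ultimately have "\<not> inj_on f B"
    using k1 by (intro pigeonhole) linarith
  then obtain x1 y1 x2 y2 where xy: "(x1, y1) \<in> B" "(x2, y2) \<in> B" "(x1, y1) \<noteq> (x2, y2)"
    "f (x1, y1) = f (x2, y2)"
    unfolding inj_on_def by fast
  have b: "(u - v)\<^sup>2 \<le> int n" if "u \<in> {0..int k}" "v \<in> {0..int k}" for u v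
  proof -
    have "\<bar>u - v\<bar> \<le> int k" using that by auto
    then have "(u - v)\<^sup>2 \<le> (int k)\<^sup>2"
      by (metis abs_ge_zero power2_abs power_mono)
    also have "\<dots> \<le> int n" using k1(1) by (metis of_nat_le_iff of_nat_power)
    finally show ?thesis .
  qed
  have "int n dvd (x1 - z * y1) - (x2 - z * y2)"
    using xy(4) by (simp add: f_def mod_eq_dvd_iff)
  then have "int n dvd (x1 - x2) - z * (y1 - y2)"
    by (simp add: algebra_simps)
  moreover have "(x1 - x2)\<^sup>2 \<le> int n" "(y1 - y2)\<^sup>2 \<le> int n"
    using xy by (auto simp: B_def intro!: b)
  ultimately show ?thesis
    using xy(3) by (intro exI[of _ "x1 - x2"] exI[of _ "y1 - y2"]) auto
qed

lemma not_square_prime: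
  assumes "prime p" shows "(x::int)\<^sup>2 \<noteq> int p"
proof
  assume h: "x\<^sup>2 = int p"
  then have "int p dvd x" using assms prime_dvd_power_int[of "int p" x 2] by simp
  then have "(int p)\<^sup>2 dvd int p" using h by (metis dvd_power_same)
  then show False
    using assms by (auto dest!: zdvd_imp_le simp: power2_eq_square prime_gt_0_nat prime_gt_1_nat)
qed

text \<open>Thue's lemma, applied to a square root \<open>z\<close> of -1, yields a multiple of
  \<open>p\<close> of the form x^2 + y^2 strictly between 0 and 2p. The upper bound is strict
  because \<open>p\<close> is not a square.\<close>

lemma prime_1_mod_4_sum_squares:
  assumes p: "prime p" "p mod 4 = 1"
  shows "\<exists>c d :: int. int p = c\<^sup>2 + d\<^sup>2"
proof -
  have p2: "2 < p" using p prime_ge_2_nat[of p] by (cases "p = 2") auto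
  then obtain z where z: "[z\<^sup>2 = -1] (mod int p)"
    using QuadRes_minus_one_iff[OF p(1) p2] p(2) unfolding QuadRes_def by auto
  obtain x y where xy: "(x, y) \<noteq> (0, 0)" "x\<^sup>2 \<le> int p" "y\<^sup>2 \<le> int p" "int p dvd x - z * y"
    using thue[of p z] p2 by auto
  have "int p dvd (x - z * y) * (x + z * y) + (z\<^sup>2 + 1) * y\<^sup>2"
    using xy(4) z by (intro dvd_add[OF dvd_mult2 dvd_mult2]) (simp_all add: cong_iff_dvd_diff)
  also have "(x - z * y) * (x + z * y) + (z\<^sup>2 + 1) * y\<^sup>2 = x\<^sup>2 + y\<^sup>2"
    by (simp add: power2_eq_square algebra_simps)
  finally obtain m where m: "x\<^sup>2 + y\<^sup>2 = int p * m" by (elim dvdE)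
  have lt: "x\<^sup>2 < int p" "y\<^sup>2 < int p"
    using xy(2,3) not_square_prime[OF p(1)] by (simp_all add: order_less_le)
  have "x\<^sup>2 + y\<^sup>2 > 0" using xy(1) by (simp add: sum_power2_gt_zero_iff)
  then have "m > 0" using m p2 by (simp add: zero_less_mult_iff)
  moreover have "int p * m < int p * 2" using m lt by simp
  ultimately have "m = 1" using p2 by simp
  then show ?thesis using m by (metis mult.right_neutral)
qed

text \<open>Division by a Gaussian prime above \<open>p\<close>: with p = c^2 + e^2,
  \<open>p\<close> divides \<open>c * X + e * Y\<close> or \<open>c * X - e * Y\<close>. For the
  matching sign the product identity writes p (X^2 + Y^2) as a sum of two squares that are both
  divisible by p^2.\<close>

lemma sum_squares_div_prime:
  fixes X Y :: int
  assumes p: "prime p" "p mod 4 = 1" and d: "int p dvd X\<^sup>2 + Y\<^sup>2"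
  shows "\<exists>X' Y'. X\<^sup>2 + Y\<^sup>2 = int p * (X'\<^sup>2 + Y'\<^sup>2)"
proof -
  obtain c e :: int where ce: "int p = c\<^sup>2 + e\<^sup>2"
    using prime_1_mod_4_sum_squares[OF p] by blast
  have "(c * X + e * Y) * (c * X - e * Y) = c\<^sup>2 * (X\<^sup>2 + Y\<^sup>2) - int p * Y\<^sup>2"
    unfolding ce by (simp add: power2_eq_square algebra_simps)
  then have "int p dvd (c * X + e * Y) * (c * X - e * Y)"
    using d by (metis dvd_diff dvd_mult dvd_triv_left)
  then have "int p dvd c * X + e * Y \<or> int p dvd c * X - e * Y"
    using p(1) by (simp add: prime_dvd_mult_iff)
  then obtain f where f: "f = e \<or> f = - e" "int p dvd c * X + f * Y"
    by (metis add_uminus_conv_diff mult_minus_left)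
  have cf: "int p = c\<^sup>2 + f\<^sup>2" using f(1) ce by auto
  have id: "int p * (X\<^sup>2 + Y\<^sup>2) = (c * X + f * Y)\<^sup>2 + (c * Y - f * X)\<^sup>2"
    unfolding cf by (simp add: power2_eq_square algebra_simps)
  obtain U where U: "c * X + f * Y = int p * U" using f(2) by (elim dvdE)
  have "int p dvd (c * Y - f * X)\<^sup>2"
  proof -
    have "(c * Y - f * X)\<^sup>2 = int p * (X\<^sup>2 + Y\<^sup>2) - (int p * U)\<^sup>2" using id U by simp
    then show ?thesis by (simp add: power_mult_distrib)
  qed
  then have "int p dvd c * Y - f * X"
    using p(1) prime_dvd_power_int[of "int p" _ 2] by simp
  then obtain V where V: "c * Y - f * X = int p * V" by (elim dvdE)
  have "int p * (X\<^sup>2 + Y\<^sup>2) = int p * (int p * (U\<^sup>2 + V\<^sup>2))"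
    unfolding id U V by (simp add: power2_eq_square algebra_simps)
  then have "X\<^sup>2 + Y\<^sup>2 = int p * (U\<^sup>2 + V\<^sup>2)"
    using p(1) prime_gt_0_nat by auto
  then show ?thesis by blast
qed

lemma sum_squares_div_prod_primes:
  assumes "finite P" "\<forall>p\<in>P. prime p \<and> p mod 4 = 1" "int (\<Prod>P) dvd X\<^sup>2 + Y\<^sup>2"
  shows "\<exists>X' Y'. X\<^sup>2 + Y\<^sup>2 = int (\<Prod>P) * (X'\<^sup>2 + Y'\<^sup>2)"
  using assms
proof (induction P arbitrary: X Y rule: finite_induct)
  case empty
  then show ?case by auto
next
  case (insert p P)
  have pr: "prime p" "p mod 4 = 1" using insert.prems by auto
  have pi: "int (\<Prod>(insert p P)) = int p * int (\<Prod>P)"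
    using insert.hyps by simp
  obtain U V where UV: "X\<^sup>2 + Y\<^sup>2 = int p * (U\<^sup>2 + V\<^sup>2)"
    using sum_squares_div_prime[OF pr, of X Y] insert.prems(2) unfolding pi
    by (meson dvd_mult_left)
  have "int (\<Prod>P) dvd U\<^sup>2 + V\<^sup>2"
    using insert.prems(2) pr(1) unfolding pi UV by (simp add: prime_gt_0_nat)
  then obtain X' Y' where "U\<^sup>2 + V\<^sup>2 = int (\<Prod>P) * (X'\<^sup>2 + Y'\<^sup>2)"
    using insert.IH insert.prems(1) by (metis insertCI)
  then show ?case unfolding UV pi by (metis mult.assoc)
qed

text \<open>Every prime factor of (2 N!)^2 + 1 exceeds \<open>N\<close>, is odd, and is not 3 mod 4,
  since such a prime would have to divide 1.\<close>

lemma infinite_primes_1_mod_4: "infinite {p::nat. prime p \<and> p mod 4 = 1}"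
proof -
  have "\<exists>p>N. prime p \<and> p mod 4 = 1" for N :: nat
  proof -
    define m where "m = 2 * fact N * 2 * (fact N :: nat) + 1"
    have "m \<noteq> 1" unfolding m_def by simp
    then obtain p where p: "prime p" "p dvd m" using prime_factor_nat by blast
    have "p > N"
    proof (rule ccontr)
      assume "\<not> p > N"
      then have "p dvd fact N" using p(1) by (simp add: prime_dvd_fact_iff)
      then have "p dvd 1" using p(2) unfolding m_def
        by (meson dvd_add_right_iff dvd_mult)
      then show False using p(1) by simp
    qed
    moreover have "odd p" using p(2) unfolding m_def
      by (metis dvd_trans even_mult_iff even_plus_one_iff even_numeral)
    moreover have "p mod 4 \<noteq> 3"
    proof
      assume h: "p mod 4 = 3"
      have "int p dvd (2 * fact N)\<^sup>2 + 1\<^sup>2"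
      proof -
        have "int m = (2 * fact N)\<^sup>2 + 1\<^sup>2"
          by (simp add: m_def power2_eq_square)
        then show ?thesis using p(2) by (metis of_nat_dvd_iff)
      qed
      from prime_3_mod_4_dvd_sum_squares[OF p(1) h this] show False using p(1) by auto
    qed
    moreover have "p mod 4 = 1 \<or> p mod 4 = 3" using \<open>odd p\<close> by presburger
    ultimately show ?thesis using p(1) by auto
  qed
  then show ?thesis
    by (metis (mono_tags, lifting) infinite_nat_iff_unbounded mem_Collect_eq)
qed

section \<open>Primes that are 3 mod 4 and divide \<open>x\<^sup>2 + \<Delta>\<close>\<close>

text \<open>Summation by parts: for a decreasing weight, a family with at most \<open>C * t\<close>
  members of size at most \<open>t\<close> weighs no more than \<open>C\<close> copies of the
  positive integers.\<close>

lemma sum_le_of_card_le: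
  fixes f :: "nat \<Rightarrow> real" and C :: real and n :: "'a \<Rightarrow> nat"
  assumes fin: "finite X" and pos: "\<And>i. i \<in> X \<Longrightarrow> n i > 0"
    and anti: "\<And>k. k > 0 \<Longrightarrow> f (Suc k) \<le> f k" and nonneg: "\<And>k. f k \<ge> 0"
    and card: "\<And>t. t > 0 \<Longrightarrow> real (card {i \<in> X. n i \<le> t}) \<le> C * real t"
  shows "(\<Sum>i | i \<in> X \<and> n i \<le> N. f (n i)) \<le> C * (\<Sum>t=1..N. f t)"
proof -
  define c where "c t = real (card {i \<in> X. n i \<le> t})" for t
  have c0: "c 0 = 0"
  proof -
    have "{i \<in> X. n i \<le> 0} = {}" using pos by force
    then show ?thesis by (simp only: c_def card.empty of_nat_0)
  qed
  have cN: "c t \<le> C * real t" for t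
    using card[of t] c0 by (cases "t = 0") (auto simp: c_def)
  \<comment> \<open>The induction carries the boundary term of the summation by parts: the slack
    \<open>C * real N - c N\<close>, weighted by \<open>f N\<close>. It is nonnegative and dropped
    at the end.\<close>
  have "(\<Sum>i | i \<in> X \<and> n i \<le> N. f (n i)) + (C * real N - c N) * f N \<le> C * (\<Sum>t=1..N. f t)"
  proof (induction N)
    case 0
    have e: "{i. i \<in> X \<and> n i \<le> 0} = {}" using pos by force
    show ?case unfolding e using c0 by simp
  next
    case (Suc N)
    have un: "{i. i \<in> X \<and> n i \<le> Suc N} = {i. i \<in> X \<and> n i \<le> N} \<union> {i \<in> X. n i = Suc N}" by auto
    have s: "(\<Sum>i | i \<in> X \<and> n i \<le> Suc N. f (n i)) =
      (\<Sum>i | i \<in> X \<and> n i \<le> N. f (n i)) + real (card {i \<in> X. n i = Suc N}) * f (Suc N)"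
      unfolding un using fin by (subst sum.union_disjoint) auto
    have cS: "c (Suc N) = c N + real (card {i \<in> X. n i = Suc N})"
      unfolding c_def un using fin by (subst card_Un_disjoint) auto
    \<comment> \<open>\<open>f\<close> decreases only from 1 on, as \<open>0 powr - s\<close> is 0
      in the application; for \<open>N = 0\<close> the factor in front vanishes.\<close>
    have "(C * real N - c N) * f (Suc N) \<le> (C * real N - c N) * f N"
      using cN[of N] anti[of N] c0 by (cases "N = 0") (auto intro: mult_left_mono)
    then show ?case
      using Suc.IH unfolding s cS by (simp add: algebra_simps)
  qed
  moreover have "0 \<le> (C * real N - c N) * f N" using cN nonneg by simp
  ultimately show ?thesis by linarith
qed

text \<open>Each factor is read as \<open>f p + (f p + 1)\<close> and the product is expanded twice;
  \<open>I\<close> and \<open>J\<close> collect the places where the first and the second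
  \<open>f p\<close> is taken. The 2 thus becomes a choice at each prime, later that of one of the
  two square roots of \<open>\<Delta>\<close>.\<close>

lemma prod_one_plus_twice:
  fixes f :: "'a \<Rightarrow> 'b::comm_semiring_1"
  assumes "finite P"
  shows "(\<Prod>p\<in>P. 1 + 2 * f p) = (\<Sum>(I, J)\<in>(SIGMA I:Pow P. Pow (P - I)). prod f I * prod f J)"
proof -
  have "(\<Prod>p\<in>P. 1 + 2 * f p) = (\<Prod>p\<in>P. f p + (f p + 1))"
    by (intro prod.cong refl) (simp add: mult_2 add.commute add.left_commute)
  also have "\<dots> = (\<Sum>I\<in>Pow P. prod f I * (\<Prod>p\<in>P - I. f p + 1))"
    by (rule prod_add[OF assms])
  also have "\<dots> = (\<Sum>I\<in>Pow P. \<Sum>J\<in>Pow (P - I). prod f I * prod f J)"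
    using assms by (intro sum.cong refl) (subst prod_add, auto simp: sum_distrib_left)
  finally show ?thesis using assms by (subst sum.Sigma[symmetric]) auto
qed

lemma prod_primes_dvd_int:
  fixes P :: "nat set"
  assumes "finite P" "\<And>p. p \<in> P \<Longrightarrow> prime p" "\<And>p. p \<in> P \<Longrightarrow> int p dvd a"
  shows "int (\<Prod>P) dvd a"
  using assms
proof (induction P rule: finite_induct)
  case (insert p P)
  have "coprime (int p) (int (\<Prod>P))"
    using insert by (auto simp flip: of_nat_prod intro!: prod_coprime_right primes_coprime)
  then show ?case
    using insert by (auto intro!: divides_mult)
qed auto

lemma prime_dvd_prod_primes:
  fixes P :: "nat set"
  assumes "finite P" "\<And>p. p \<in> P \<Longrightarrow> prime p" "prime p" "p dvd \<Prod>P"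
  shows "p \<in> P"
  using assms prime_dvd_prod_iff[of P p id] primes_dvd_imp_eq[of p] by (auto simp: id_def)

lemma square_not_dvd_prod_primes:
  fixes P :: "nat set"
  assumes P: "finite P" "\<And>p. p \<in> P \<Longrightarrow> prime p" and p: "p \<in> P"
  shows "\<not> p\<^sup>2 dvd \<Prod>P"
proof
  assume "p\<^sup>2 dvd \<Prod>P"
  then have "p * p dvd p * \<Prod>(P - {p})"
    using prod.remove[OF P(1) p, of id] by (simp add: power2_eq_square)
  then have "p dvd \<Prod>(P - {p})" using P(2)[OF p] prime_gt_0_nat[of p] by simp
  then have "p \<in> P - {p}" by (intro prime_dvd_prod_primes) (use P p in auto)
  then show False by simp
qed

text \<open>The bound is uniform in \<open>P\<close>: by Thue's lemma each coprime pair \<open>(u, v)\<close> of products of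
  primes from \<open>P\<close>, i.e. each square root of \<open>\<Delta>\<close> modulo \<open>u v\<close>, produces a point \<open>(x, y)\<close> with
  \<open>x\<^sup>2 - \<Delta> y\<^sup>2 = u v k\<close> and bounded \<open>k \<noteq> 0\<close>, from which the pair can be recovered.\<close>

lemma card_split_pairs_le:
  fixes \<Delta> :: int and P :: "nat set"
  assumes nz: "\<Delta> \<noteq> 0" and nsq: "\<And>x y. x\<^sup>2 = \<Delta> * y\<^sup>2 \<Longrightarrow> y = 0" and P: "finite P"
    and pr: "\<And>p. p \<in> P \<Longrightarrow> prime p" and big: "\<And>p. p \<in> P \<Longrightarrow> \<bar>\<Delta>\<bar> + 1 < int p"
    and res: "\<And>p. p \<in> P \<Longrightarrow> QuadRes (int p) \<Delta>" and t: "t > 0"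
  shows "real (card {(I, J) \<in> (SIGMA I:Pow P. Pow (P - I)). \<Prod>I * \<Prod>J \<le> t})
    \<le> 9 * (2 * real_of_int \<bar>\<Delta>\<bar> + 3) * real t"
proof -
  define Z where "Z = {(I, J) \<in> (SIGMA I:Pow P. Pow (P - I)). \<Prod>I * \<Prod>J \<le> t}"
  define R where "R = int (floor_sqrt t)"
  define B where "B = \<bar>\<Delta>\<bar> + 1"
  \<comment> \<open>The box for the triples \<open>(x, y, k)\<close>: Thue's lemma bounds
    \<open>x\<close> and \<open>y\<close> by the root of \<open>t\<close>, and then |x^2 - \<Delta>
    y^2| \<le> n (1 + |\<Delta>|) bounds \<open>k\<close>. It has O(t) points.\<close>
  define W where "W = {-R..R} \<times> {-R..R} \<times> {-B..B}"
  have gt2: "2 < p" if "p \<in> P" for p using big[OF that] nz by linarith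
  have "\<forall>p\<in>P. \<exists>z. int p dvd z\<^sup>2 - \<Delta>"
    using res unfolding QuadRes_def by (simp add: cong_iff_dvd_diff)
  then obtain \<zeta> where zeta: "\<And>p. p \<in> P \<Longrightarrow> int p dvd (\<zeta> p)\<^sup>2 - \<Delta>" by metis
  have zeta_nd: "\<not> int p dvd \<zeta> p" if "p \<in> P" for p
  proof
    assume "int p dvd \<zeta> p"
    then have "int p dvd (\<zeta> p)\<^sup>2 - ((\<zeta> p)\<^sup>2 - \<Delta>)"
      using zeta[OF that] by (metis dvd_diff dvd_mult power2_eq_square)
    then have "int p dvd \<Delta>" by simp
    then show False using nz big[OF that] dvd_imp_le_int[of \<Delta> "int p"] by linarith
  qed
  have "\<exists>x y k. (x, y, k) \<in> W \<and> k \<noteq> 0 \<and> x\<^sup>2 - \<Delta> * y\<^sup>2 = int (\<Prod>I * \<Prod>J) * k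
      \<and> (\<forall>p\<in>I. int p dvd x - \<zeta> p * y) \<and> (\<forall>p\<in>J. int p dvd x + \<zeta> p * y)"
    if IJ: "(I, J) \<in> Z" for I J
  proof -
    have sub: "I \<subseteq> P" "J \<subseteq> P" "I \<inter> J = {}" "\<Prod>I * \<Prod>J \<le> t"
      using IJ by (auto simp: Z_def)
    have fin: "finite (I \<union> J)" using sub P by (meson finite_subset le_sup_iff)
    define n where "n = \<Prod>(I \<union> J)"
    have n: "n = \<Prod>I * \<Prod>J"
      unfolding n_def using fin sub(3) by (subst prod.union_disjoint) auto
    have n0: "n > 0" unfolding n_def using pr sub by (intro prod_pos) (auto simp: prime_gt_0_nat)
    \<comment> \<open>The pair \<open>(I, J)\<close> is encoded as a square root \<open>z\<close> of
      \<open>\<Delta>\<close> modulo \<open>n\<close>, equal to \<open>\<zeta> p\<close> at the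
      primes of \<open>I\<close> and to \<open>- \<zeta> p\<close> at those of
      \<open>J\<close>.\<close>
    have "\<exists>z. \<forall>p\<in>I \<union> J. [z = nat ((if p \<in> I then \<zeta> p else - \<zeta> p) mod int p)] (mod p)"
      by (rule chinese_remainder_nat[OF fin]) (use sub pr in \<open>auto intro!: primes_coprime\<close>)
    then obtain z where z: "\<And>p. p \<in> I \<union> J \<Longrightarrow>
        [z = nat ((if p \<in> I then \<zeta> p else - \<zeta> p) mod int p)] (mod p)" by blast
    have z': "int p dvd int z - (if p \<in> I then \<zeta> p else - \<zeta> p)" if "p \<in> I \<union> J" for p
    proof -
      have "p > 0" using pr sub that by (auto simp: prime_gt_0_nat)
      then have "[int z = (if p \<in> I then \<zeta> p else - \<zeta> p) mod int p] (mod int p)"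
        using z[OF that] by (metis cong_int_iff int_nat_eq of_nat_0_less_iff pos_mod_sign)
      then have "[int z = (if p \<in> I then \<zeta> p else - \<zeta> p)] (mod int p)"
        by (simp only: cong_mod_right)
      then show ?thesis by (simp only: cong_iff_dvd_diff)
    qed
    obtain x y where xy: "(x, y) \<noteq> (0, 0)" "x\<^sup>2 \<le> int n" "y\<^sup>2 \<le> int n" "int n dvd x - int z * y"
      using thue[OF n0] by blast
    have xI: "int p dvd x - (if p \<in> I then \<zeta> p else - \<zeta> p) * y" if "p \<in> I \<union> J" for p
    proof -
      have "int p dvd int n" using that fin unfolding n_def by (simp add: dvd_prodI)
      then have "int p dvd (x - int z * y) + (int z - (if p \<in> I then \<zeta> p else - \<zeta> p)) * y"
        using xy(4) z'[OF that] by (intro dvd_add) (auto intro: dvd_trans)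
      then show ?thesis by (simp add: algebra_simps split: if_splits)
    qed
    have "int p dvd x\<^sup>2 - \<Delta> * y\<^sup>2" if "p \<in> I \<union> J" for p
    proof -
      define w where "w = (if p \<in> I then \<zeta> p else - \<zeta> p)"
      have "int p dvd (x - w * y) * (x + w * y) + (w\<^sup>2 - \<Delta>) * y\<^sup>2"
        using xI[OF that] zeta[of p] that sub by (intro dvd_add dvd_mult2) (auto simp: w_def)
      also have "(x - w * y) * (x + w * y) + (w\<^sup>2 - \<Delta>) * y\<^sup>2 = x\<^sup>2 - \<Delta> * y\<^sup>2"
        by (simp add: power2_eq_square algebra_simps)
      finally show ?thesis .
    qed
    then have "int n dvd x\<^sup>2 - \<Delta> * y\<^sup>2"
      unfolding n_def using sub pr fin by (intro prod_primes_dvd_int) auto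
    then obtain k where k: "x\<^sup>2 - \<Delta> * y\<^sup>2 = int n * k" by (elim dvdE)
    have k0: "k \<noteq> 0"
    proof
      assume "k = 0"
      then have "x\<^sup>2 = \<Delta> * y\<^sup>2" using k by simp
      then show False using nsq[of x y] xy(1) by auto
    qed
    have "\<bar>x\<^sup>2 - \<Delta> * y\<^sup>2\<bar> \<le> x\<^sup>2 + \<bar>\<Delta>\<bar> * y\<^sup>2"
      by (metis abs_mult abs_power2 abs_triangle_ineq4)
    also have "\<dots> \<le> int n + \<bar>\<Delta>\<bar> * int n"
      using xy by (intro add_mono mult_left_mono) auto
    finally have "int n * \<bar>k\<bar> \<le> int n * B" unfolding k B_def
      by (simp add: abs_mult algebra_simps)
    then have kB: "\<bar>k\<bar> \<le> B" using n0 by simp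
    have "\<bar>u\<bar> \<le> R" if "u\<^sup>2 \<le> int n" for u
    proof -
      have "(nat \<bar>u\<bar>)\<^sup>2 \<le> t"
      proof -
        have "int ((nat \<bar>u\<bar>)\<^sup>2) \<le> int n" using that by simp
        then show ?thesis using sub(4) n by (simp only: of_nat_le_iff)
      qed
      then show ?thesis unfolding R_def by (simp add: nat_le_iff flip: le_floor_sqrt_iff)
    qed
    then have "\<bar>x\<bar> \<le> R" "\<bar>y\<bar> \<le> R" using xy by auto
    then have "(x, y, k) \<in> W" using kB by (auto simp: W_def abs_le_iff)
    moreover have "\<forall>p\<in>I. int p dvd x - \<zeta> p * y" using xI by fastforce
    moreover have "\<forall>p\<in>J. int p dvd x + \<zeta> p * y"
    proof
      fix p assume "p \<in> J"
      then have "p \<notin> I" using sub by auto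
      then show "int p dvd x + \<zeta> p * y" using xI[of p] \<open>p \<in> J\<close> by simp
    qed
    ultimately show ?thesis using k k0 n by metis
  qed
  then have "\<forall>IJ\<in>Z. \<exists>g. g \<in> W \<and> snd (snd g) \<noteq> 0
      \<and> (fst g)\<^sup>2 - \<Delta> * (fst (snd g))\<^sup>2 = int (\<Prod>(fst IJ) * \<Prod>(snd IJ)) * snd (snd g)
      \<and> (\<forall>p\<in>fst IJ. int p dvd fst g - \<zeta> p * fst (snd g))
      \<and> (\<forall>p\<in>snd IJ. int p dvd fst g + \<zeta> p * fst (snd g))"
    by fastforce
  then obtain g where g: "\<And>IJ. IJ \<in> Z \<Longrightarrow> g IJ \<in> W \<and> snd (snd (g IJ)) \<noteq> 0
      \<and> (fst (g IJ))\<^sup>2 - \<Delta> * (fst (snd (g IJ)))\<^sup>2 = int (\<Prod>(fst IJ) * \<Prod>(snd IJ)) * snd (snd (g IJ))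
      \<and> (\<forall>p\<in>fst IJ. int p dvd fst (g IJ) - \<zeta> p * fst (snd (g IJ)))
      \<and> (\<forall>p\<in>snd IJ. int p dvd fst (g IJ) + \<zeta> p * fst (snd (g IJ)))"
    by metis
  \<comment> \<open>Dividing x^2 - \<Delta> y^2 by \<open>k\<close> gives back \<open>n\<close> and
    hence the union of \<open>I\<close> and \<open>J\<close>; the congruence of \<open>x\<close> and
    \<open>\<zeta> p * y\<close> modulo \<open>p\<close> then tells \<open>I\<close> from
    \<open>J\<close>.\<close>
  have recover: "I = {p \<in> P. int p dvd (x\<^sup>2 - \<Delta> * y\<^sup>2) div k \<and> int p dvd x - \<zeta> p * y} \<and>
      J = {p \<in> P. int p dvd (x\<^sup>2 - \<Delta> * y\<^sup>2) div k \<and> \<not> int p dvd x - \<zeta> p * y}"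
    if IJ: "(I, J) \<in> Z" and e: "g (I, J) = (x, y, k)" for I J x y k
  proof -
    have sub: "I \<subseteq> P" "J \<subseteq> P" "I \<inter> J = {}"
      using IJ by (auto simp: Z_def)
    have fin: "finite (I \<union> J)" using sub P by (meson finite_subset le_sup_iff)
    define n where "n = \<Prod>(I \<union> J)"
    have n: "n = \<Prod>I * \<Prod>J"
      unfolding n_def using fin sub(3) by (subst prod.union_disjoint) auto
    note g' = g[OF IJ, unfolded e fst_conv snd_conv, folded n]
    have k: "k \<noteq> 0" "\<bar>k\<bar> \<le> B" using g' by (auto simp: W_def abs_le_iff)
    have q: "(x\<^sup>2 - \<Delta> * y\<^sup>2) div k = int n" using g' k by simp
    have mem: "int p dvd int n \<longleftrightarrow> p \<in> I \<union> J" if "p \<in> P" for p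
    proof
      assume "int p dvd int n"
      then show "p \<in> I \<union> J" unfolding n_def using fin sub pr that
        by (intro prime_dvd_prod_primes) (auto simp flip: of_nat_prod)
    next
      assume "p \<in> I \<union> J"
      then show "int p dvd int n" using fin unfolding n_def by (simp add: dvd_prodI)
    qed
    \<comment> \<open>Otherwise \<open>p\<close> also divides \<open>x\<close>, so p^2 divides
      \<open>n * k\<close>. But \<open>k\<close> is nonzero with |k| < p, and \<open>n\<close> is
      squarefree.\<close>
    have ynd: "\<not> int p dvd y" if p: "p \<in> I \<union> J" for p
    proof
      assume y: "int p dvd y"
      have pP: "p \<in> P" using p sub by auto
      have "int p dvd x"
      proof -
        have "int p dvd x - \<zeta> p * y \<or> int p dvd x + \<zeta> p * y" using g' p by blast
        moreover have "int p dvd \<zeta> p * y" using y by simp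
        ultimately show ?thesis
          by (metis add_diff_cancel_right' diff_add_cancel dvd_add dvd_diff)
      qed
      then have "(int p)\<^sup>2 dvd int n * k"
        using y g' by (metis dvd_diff dvd_mult dvd_power_same)
      moreover have "coprime ((int p)\<^sup>2) k"
      proof -
        have "\<not> int p dvd k" using k big[OF pP] dvd_imp_le_int[of k "int p"] by (auto simp: B_def)
        then show ?thesis using pr[OF pP] by (simp add: prime_imp_coprime)
      qed
      ultimately have "(int p)\<^sup>2 dvd int n" by (simp add: coprime_dvd_mult_left_iff)
      then have "p\<^sup>2 dvd n" by (metis of_nat_dvd_iff of_nat_power)
      then show False using square_not_dvd_prod_primes[of "I \<union> J" p] fin sub pr p
        unfolding n_def by blast
    qed
    have nd: "\<not> int p dvd x - \<zeta> p * y" if p: "p \<in> J" for p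
    proof
      assume h: "int p dvd x - \<zeta> p * y"
      have pP: "p \<in> P" using p sub by auto
      have "int p dvd (x + \<zeta> p * y) - (x - \<zeta> p * y)"
        using h g' p by (intro dvd_diff[OF _ h]) blast
      also have "(x + \<zeta> p * y) - (x - \<zeta> p * y) = 2 * (\<zeta> p * y)" by simp
      finally have "int p dvd \<zeta> p * y"
        using prime_not_dvd_twice[OF pr[OF pP] gt2[OF pP]] by blast
      then show False using zeta_nd[OF pP] ynd[of p] p pr[OF pP] by (auto simp: prime_dvd_mult_iff)
    qed
    have gI: "\<forall>p\<in>I. int p dvd x - \<zeta> p * y" using g' by blast
    show ?thesis unfolding q using mem nd gI sub by blast
  qed
  have "inj_on g Z"
  proof (rule inj_onI)
    fix a b assume ab: "a \<in> Z" "b \<in> Z" "g a = g b"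
    obtain x y k where e: "g b = (x, y, k)" by (metis prod_cases3)
    show "a = b"
      using recover[of "fst a" "snd a" x y k] recover[of "fst b" "snd b" x y k] ab e
      by (metis prod.collapse)
  qed
  moreover have "g ` Z \<subseteq> W" using g by blast
  moreover have "finite W" by (simp add: W_def)
  ultimately have "card Z \<le> card W" by (rule card_inj_on_le)
  also have "real (card W) = (2 * real (floor_sqrt t) + 1)\<^sup>2 * (2 * real_of_int \<bar>\<Delta>\<bar> + 3)"
  proof -
    have "card W = nat (2 * R + 1) * (nat (2 * R + 1) * nat (2 * B + 1))"
      by (simp add: W_def algebra_simps)
    then show ?thesis
      by (simp add: R_def B_def power2_eq_square)
  qed
  also have "\<dots> \<le> 9 * real t * (2 * real_of_int \<bar>\<Delta>\<bar> + 3)"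
  proof (rule mult_right_mono)
    have "floor_sqrt t \<ge> 1" using t by (simp add: le_floor_sqrt_iff Suc_le_eq)
    then have "(2 * real (floor_sqrt t) + 1)\<^sup>2 \<le> (3 * real (floor_sqrt t))\<^sup>2"
      by (intro power_mono) auto
    also have "\<dots> = 9 * real ((floor_sqrt t)\<^sup>2)" by (simp add: power_mult_distrib)
    also have "\<dots> \<le> 9 * real t" using floor_sqrt_power2_le[of t] by (intro mult_left_mono) (simp_all only: of_nat_le_iff zero_le_numeral)
    finally show "(2 * real (floor_sqrt t) + 1)\<^sup>2 \<le> 9 * real t" .
  qed simp
  finally show ?thesis by (simp add: Z_def mult_ac)
qed

text \<open>The expanded product is a sum of n^(-s) over the pairs \<open>(I, J)\<close>, where n is
  the product of all their primes. By the count of pairs, summation by parts bounds it by a partial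
  sum of \<zeta>(s), with a constant independent of \<open>P\<close>.\<close>

lemma prod_split_primes_le:
  fixes \<Delta> :: int and P :: "nat set"
  assumes nz: "\<Delta> \<noteq> 0" and nsq: "\<And>x y. x\<^sup>2 = \<Delta> * y\<^sup>2 \<Longrightarrow> y = 0" and P: "finite P"
    and pr: "\<And>p. p \<in> P \<Longrightarrow> prime p" and big: "\<And>p. p \<in> P \<Longrightarrow> \<bar>\<Delta>\<bar> + 1 < int p"
    and res: "\<And>p. p \<in> P \<Longrightarrow> QuadRes (int p) \<Delta>" and s: "s \<ge> 0"
  shows "\<exists>N. (\<Prod>p\<in>P. 1 + 2 * real p powr - s)
    \<le> 9 * (2 * real_of_int \<bar>\<Delta>\<bar> + 3) * (\<Sum>t=1..N. real t powr - s)"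
proof -
  define Y where "Y = (SIGMA I:Pow P. Pow (P - I))"
  define n where "n = (\<lambda>(I, J). \<Prod>I * \<Prod>J :: nat)"
  have finY: "finite Y" using P by (auto simp: Y_def)
  have npos: "n i > 0" if "i \<in> Y" for i
    using that prime_gt_0_nat[OF pr] by (force simp: Y_def n_def intro!: mult_pos_pos prod_pos)
  obtain N where N: "\<forall>i\<in>Y. n i \<le> N" using finY by (metis finite_imageI finite_nat_set_iff_bounded_le imageI)
  have "(\<Prod>p\<in>P. 1 + 2 * real p powr - s) = (\<Sum>(I, J)\<in>Y. (\<Prod>p\<in>I. real p powr - s) * (\<Prod>p\<in>J. real p powr - s))"
    unfolding Y_def using P by (rule prod_one_plus_twice)
  also have "\<dots> = (\<Sum>i\<in>Y. real (n i) powr - s)"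
  proof (rule sum.cong[OF refl], clarify)
    fix I J
    show "(\<Prod>p\<in>I. real p powr - s) * (\<Prod>p\<in>J. real p powr - s) = real (n (I, J)) powr - s"
      by (simp add: n_def powr_mult prod_nonneg flip: prod_powr_distrib)
  qed
  also have "\<dots> = (\<Sum>i | i \<in> Y \<and> n i \<le> N. real (n i) powr - s)"
    using N by (intro sum.cong) auto
  also have "\<dots> \<le> 9 * (2 * real_of_int \<bar>\<Delta>\<bar> + 3) * (\<Sum>t=1..N. real t powr - s)"
  proof (rule sum_le_of_card_le[OF finY npos])
    show "real (Suc k) powr - s \<le> real k powr - s" if "k > 0" for k
      using that s by (intro powr_mono2') auto
    show "real (card {i \<in> Y. n i \<le> t}) \<le> 9 * (2 * real_of_int \<bar>\<Delta>\<bar> + 3) * real t" if "t > 0" for t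
    proof -
      have "{i \<in> Y. n i \<le> t} = {(I, J) \<in> (SIGMA I:Pow P. Pow (P - I)). \<Prod>I * \<Prod>J \<le> t}"
        by (auto simp: Y_def n_def)
      then show ?thesis using card_split_pairs_le[OF nz nsq P pr big res that] by simp
    qed
  qed auto
  finally show ?thesis by blast
qed

section \<open>Comparison of Euler products with \<zeta>(s)\<close>

lemma sum_inverse_squares_le: "(\<Sum>w=1..N. 1 / (real w)\<^sup>2) \<le> 2"
proof -
  \<comment> \<open>The sharper bound 2 - 1/N lets the induction telescope.\<close>
  have "(\<Sum>w=1..N. 1 / (real w)\<^sup>2) \<le> 2 - 1 / real N" if "N > 0"
    using that
  proof (induction N rule: nat_induct_non_zero)
    case (Suc n)
    have "1 / (real (Suc n))\<^sup>2 \<le> 1 / (real n * real (Suc n))"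
      using Suc.hyps by (intro divide_left_mono) (auto simp: power2_eq_square)
    also have "\<dots> = 1 / real n - 1 / real (Suc n)"
      using Suc.hyps by (simp add: field_simps)
    finally show ?case using Suc.IH by simp
  qed auto
  then show ?thesis by (cases "N = 0") (auto simp: order_trans[where y = "2 - 1 / real N"])
qed

lemma squarefree_eq_prod_prime_factors:
  fixes m :: nat
  assumes "squarefree m"
  shows "m = \<Prod>(prime_factors m)"
proof -
  have m: "m \<noteq> 0" using assms by (metis not_squarefree_0)
  have "m = (\<Prod>p\<in>prime_factors m. p ^ multiplicity p m)"
    using prime_factorization_nat[of m] m by simp
  also have "\<dots> = \<Prod>(prime_factors m)"
    using assms m by (intro prod.cong) (auto simp: squarefree_factorial_semiring')
  finally show ?thesis .
qed

text \<open>Every such \<open>n\<close> is a squarefree number, that is, the product of a subset of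
  \<open>Q\<close>, times a square. As \<open>s \<ge> 1\<close>, the squares contribute at most the
  sum of 1/w^2.\<close>

lemma sum_powr_smooth_le:
  fixes Q :: "nat set"
  assumes Q: "finite Q" and s: "s \<ge> 1"
  shows "(\<Sum>n | n \<in> {1..N} \<and> (\<forall>p. prime p \<longrightarrow> p dvd n \<longrightarrow> p \<in> Q). real n powr - s)
    \<le> 2 * (\<Prod>p\<in>Q. 1 + real p powr - s)"
proof -
  let ?f = "\<lambda>n::nat. real n powr - s"
  have "(\<Sum>n | n \<in> {1..N} \<and> (\<forall>p. prime p \<longrightarrow> p dvd n \<longrightarrow> p \<in> Q). ?f n)
    \<le> (\<Sum>(I, w)\<in>Pow Q \<times> {1..N}. ?f (\<Prod>I * w\<^sup>2))"
  proof (rule sum_le_included[where i = "\<lambda>(I, w :: nat). \<Prod>I * w\<^sup>2"])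
    show "\<forall>n\<in>{n \<in> {1..N}. \<forall>p. prime p \<longrightarrow> p dvd n \<longrightarrow> p \<in> Q}. \<exists>y\<in>Pow Q \<times> {1..N}.
      (case y of (I, w :: nat) \<Rightarrow> \<Prod>I * w\<^sup>2) = n \<and> ?f n \<le> (case y of (I, w) \<Rightarrow> ?f (\<Prod>I * w\<^sup>2))"
    proof clarify
      fix n assume n: "n \<in> {1..N}" "\<forall>p. prime p \<longrightarrow> p dvd n \<longrightarrow> p \<in> Q"
      define I where "I = prime_factors (squarefree_part n)"
      define w where "w = square_part n"
      have nIw: "n = \<Prod>I * w\<^sup>2"
        using squarefree_decompose[of n] squarefree_eq_prod_prime_factors[of "squarefree_part n"]
        by (simp add: I_def w_def)
      have "I \<subseteq> Q"
      proof
        fix p assume "p \<in> I"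
        then have "prime p" "p dvd squarefree_part n" by (auto simp: I_def)
        moreover have "squarefree_part n dvd n" by (metis squarefree_decompose dvd_triv_left)
        ultimately show "p \<in> Q" using n(2) by (meson dvd_trans)
      qed
      moreover have "w \<ge> 1" using n by (simp add: w_def Suc_le_eq flip: neq0_conv)
      moreover have "w \<le> N"
      proof -
        have "w dvd n" using nIw by (metis dvd_mult power2_eq_square dvd_triv_left)
        then show ?thesis using n by (auto dest: dvd_imp_le)
      qed
      ultimately show "\<exists>y\<in>Pow Q \<times> {1..N}. (case y of (I, w) \<Rightarrow> \<Prod>I * w\<^sup>2) = n \<and>
          ?f n \<le> (case y of (I, w) \<Rightarrow> ?f (\<Prod>I * w\<^sup>2))"
        using nIw by (intro bexI[of _ "(I, w)"]) auto
    qed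
  qed (use Q in auto)
  also have "\<dots> = (\<Sum>I\<in>Pow Q. prod ?f I) * (\<Sum>w=1..N. ?f (w\<^sup>2))"
    by (simp add: sum_product sum.cartesian_product powr_mult prod_nonneg flip: prod_powr_distrib)
  also have "\<dots> \<le> (\<Sum>I\<in>Pow Q. prod ?f I) * 2"
  proof (rule mult_left_mono)
    have "(\<Sum>w=1..N. ?f (w\<^sup>2)) \<le> (\<Sum>w=1..N. 1 / (real w)\<^sup>2)"
    proof (rule sum_mono)
      fix w assume "w \<in> {1..N}"
      then have "?f (w\<^sup>2) \<le> real (w\<^sup>2) powr - 1"
        using s by (intro powr_mono) auto
      then show "?f (w\<^sup>2) \<le> 1 / (real w)\<^sup>2"
        by (simp add: powr_minus field_simps)
    qed
    also have "\<dots> \<le> 2" by (rule sum_inverse_squares_le)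
    finally show "(\<Sum>w=1..N. ?f (w\<^sup>2)) \<le> 2" .
  qed (auto intro!: sum_nonneg prod_nonneg)
  also have "(\<Sum>I\<in>Pow Q. prod ?f I) = (\<Prod>p\<in>Q. ?f p + 1)"
    using prod_add[OF Q, of ?f "\<lambda>_. 1"] by simp
  finally show ?thesis by (simp add: mult.commute add.commute)
qed

text \<open>With \<open>A\<close>, \<open>B\<close>, \<open>C\<close> the products of \<open>1 + 2p\<^sup>-\<^sup>s\<close> over the primes that are 3 mod 4, those that are
  1 mod 4 and split by \<open>\<Delta>\<close>, and the remaining ones: \<open>A B\<close> and \<open>B C\<close> are \<open>O(\<zeta>(s))\<close>, whereas
  \<open>A B C\<close> is at least of order \<open>\<zeta>(s)\<^sup>2\<close>. Hence \<open>B\<close> is bounded as \<open>s \<rightarrow> 1\<close>.\<close>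

lemma prod_common_split_primes_bounded:
  fixes \<Delta> :: int and K :: nat
  assumes pos: "\<Delta> > 0" and nsq: "\<And>x y. x\<^sup>2 = \<Delta> * y\<^sup>2 \<Longrightarrow> y = 0"
    and hyp: "\<And>p. prime p \<Longrightarrow> p > K \<Longrightarrow> p mod 4 = 3 \<Longrightarrow> \<not> QuadRes (int p) (- \<Delta>)"
    and K: "K > nat \<Delta> + 2"
  shows "\<exists>C. \<forall>P. finite P \<longrightarrow>
    P \<subseteq> {p. prime p \<and> K < p \<and> p mod 4 = 1 \<and> QuadRes (int p) \<Delta>} \<longrightarrow>
    (\<Prod>p\<in>P. 1 + 1 / real p) \<le> C"
proof -
  \<comment> \<open>\<open>C1\<close> and \<open>C2\<close> are the constants of
    \<open>prod_split_primes_le\<close> for \<open>\<Delta>\<close> and for -1. \<open>G\<close>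
    bounds the factors of the primes up to \<open>K\<close>; 4 and \<open>exp 2\<close> come from
    the comparison of \<open>(Z Y)\<^sup>2\<close> with the full product.\<close>
  define C1 where "C1 = 9 * (2 * real_of_int \<bar>\<Delta>\<bar> + 3)"
  define C2 where "C2 = 9 * (2 * real_of_int \<bar>-1\<bar> + 3)"
  define G :: real where "G = 3 ^ card {p::nat. prime p \<and> p \<le> K}"
  define C where "C = 4 * exp 2 * G * (C1 * C2)"
  have Cpos: "C1 \<ge> 0" "C2 \<ge> 0" "G \<ge> 0" by (auto simp: C1_def C2_def G_def)
  have gt2: "2 < p" and nd: "\<not> int p dvd \<Delta>" "\<not> int p dvd -1" and big: "\<bar>\<Delta>\<bar> + 1 < int p" "\<bar>-1::int\<bar> + 1 < int p"
    if "prime p" "K < p" for p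
  proof -
    show "2 < p" "\<bar>\<Delta>\<bar> + 1 < int p" "\<bar>-1::int\<bar> + 1 < int p" using that K pos by auto
    show "\<not> int p dvd \<Delta>" using that K pos zdvd_imp_le[of "int p" \<Delta>] by auto
    show "\<not> int p dvd -1" using that by auto
  qed
  \<comment> \<open>For these primes neither -1 nor, by \<open>hyp\<close>,
    \<open>- \<Delta>\<close> is a residue; hence their product \<open>\<Delta>\<close> is
    one.\<close>
  have QA: "QuadRes (int p) \<Delta>" if "prime p" "K < p" "p mod 4 = 3" for p
    using hyp[OF that] QuadRes_mult_iff[of p "-1" \<Delta>] QuadRes_minus_one_iff[of p]
      gt2[of p] nd[of p] that by auto
  have bound: "(\<Prod>p\<in>P. 1 + 2 * real p powr - s) \<le> C"
    if s: "s > 1" and P: "finite P"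
      "P \<subseteq> {p. prime p \<and> K < p \<and> p mod 4 = 1 \<and> QuadRes (int p) \<Delta>}" for s and P :: "nat set"
  proof -
    let ?f = "\<lambda>p::nat. 1 + 2 * real p powr - s"
    let ?g = "\<lambda>n::nat. real n powr - s"
    define \<zeta> where "\<zeta> = suminf ?g"
    define Z where "Z Y = (\<Sum>n=1..Y. ?g n)" for Y
    define A where "A Y = {p::nat. prime p \<and> K < p \<and> p \<le> Y \<and> p mod 4 = 3}" for Y
    define B where "B Y = {p::nat. prime p \<and> K < p \<and> p \<le> Y \<and> p mod 4 = 1 \<and> QuadRes (int p) \<Delta>}" for Y
    define E where "E Y = {p::nat. prime p \<and> K < p \<and> p \<le> Y \<and> p mod 4 = 1 \<and> \<not> QuadRes (int p) \<Delta>}" for Y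
    have fin: "finite (A Y)" "finite (B Y)" "finite (E Y)" for Y
      by (auto simp: A_def B_def E_def)
    have summ: "summable ?g" using s by (simp add: summable_real_powr_iff)
    have Zs: "Z Y = (\<Sum>n\<le>Y. ?g n)" for Y
    proof -
      have "{..Y} = insert 0 {1..Y}" by auto
      then show ?thesis by (simp add: Z_def)
    qed
    have Zle: "Z Y \<le> \<zeta>" for Y
      unfolding Zs \<zeta>_def by (intro sum_le_suminf summ) auto
    have Zlim: "Z \<longlonglongrightarrow> \<zeta>"
      unfolding Zs \<zeta>_def using summable_LIMSEQ'[OF summ] by (simp add: Zs[abs_def])
    have "Z 1 = 1" by (simp add: Z_def)
    then have zpos: "\<zeta> > 0" using Zle[of 1] by simp
    have Zpos: "Z Y \<ge> 0" for Y by (simp add: Z_def sum_nonneg)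
    have f1: "?f p \<ge> 1" for p by simp
    have fpos: "prod ?f S \<ge> 0" "prod ?f S \<ge> 1" for S
      by (auto intro!: prod_nonneg prod_ge_1)
    have AB: "prod ?f (A Y) * prod ?f (B Y) \<le> C1 * \<zeta>" for Y
    proof -
      have "prod ?f (A Y) * prod ?f (B Y) = prod ?f (A Y \<union> B Y)"
        using fin by (intro prod.union_disjoint[symmetric]) (auto simp: A_def B_def)
      also have "\<exists>N. prod ?f (A Y \<union> B Y) \<le> C1 * Z N"
        unfolding Z_def C1_def using pos fin s big(1) QA
        by (intro prod_split_primes_le[OF _ nsq]) (auto simp: A_def B_def)
      then obtain N where "prod ?f (A Y \<union> B Y) \<le> C1 * Z N" by blast
      also have "C1 * Z N \<le> C1 * \<zeta>" using Zle Cpos by (intro mult_left_mono) auto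
      finally show ?thesis by simp
    qed
    have BE: "prod ?f (B Y) * prod ?f (E Y) \<le> C2 * \<zeta>" for Y
    proof -
      have sq: "y = 0" if "x\<^sup>2 = -1 * y\<^sup>2" for x y :: int
      proof -
        have "x\<^sup>2 + y\<^sup>2 = 0" using that by simp
        then show ?thesis by (simp add: sum_power2_eq_zero_iff)
      qed
      have res: "QuadRes (int p) (-1)" if "p \<in> B Y \<union> E Y" for p
        using that QuadRes_minus_one_iff[of p] gt2[of p] by (auto simp: B_def E_def)
      have "prod ?f (B Y) * prod ?f (E Y) = prod ?f (B Y \<union> E Y)"
        using fin by (intro prod.union_disjoint[symmetric]) (auto simp: B_def E_def)
      also have "\<exists>N. prod ?f (B Y \<union> E Y) \<le> C2 * Z N"
        unfolding Z_def C2_def using fin s big(2) res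
        by (intro prod_split_primes_le[OF _ sq]) (auto simp: B_def E_def)
      then obtain N where "prod ?f (B Y \<union> E Y) \<le> C2 * Z N" by blast
      also have "C2 * Z N \<le> C2 * \<zeta>" using Zle Cpos by (intro mult_left_mono) auto
      finally show ?thesis by simp
    qed
    have ABE: "(Z Y)\<^sup>2 \<le> 4 * exp 2 * G * (prod ?f (A Y) * prod ?f (B Y) * prod ?f (E Y))" for Y
    proof -
      define Q where "Q = {p::nat. prime p \<and> p \<le> Y}"
      define S where "S = {p::nat. prime p \<and> p \<le> K}"
      have finQ: "finite Q" "finite S" by (auto simp: Q_def S_def)
      have "Z Y = (\<Sum>n | n \<in> {1..Y} \<and> (\<forall>p. prime p \<longrightarrow> p dvd n \<longrightarrow> p \<in> Q). ?g n)"
        unfolding Z_def by (intro sum.cong) (auto simp: Q_def dest: dvd_imp_le)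
      also have "\<dots> \<le> 2 * (\<Prod>p\<in>Q. 1 + ?g p)"
        using s by (intro sum_powr_smooth_le finQ) auto
      finally have "(Z Y)\<^sup>2 \<le> (2 * (\<Prod>p\<in>Q. 1 + ?g p))\<^sup>2"
        using Zpos by (intro power_mono) auto
      also have "\<dots> = 4 * (\<Prod>p\<in>Q. (1 + ?g p)\<^sup>2)"
        by (simp add: power_mult_distrib prod_power_distrib)
      \<comment> \<open>(1 + u)^2 \<le> (1 + 2u)(1 + u^2) for u \<ge> 0. The second factors have a
        bounded product, because the sum of p^(-2s) is at most 2.\<close>
      also have "(\<Prod>p\<in>Q. (1 + ?g p)\<^sup>2) \<le> (\<Prod>p\<in>Q. ?f p * (1 + (?g p)\<^sup>2))"
        by (intro prod_mono) (auto simp: power2_eq_square algebra_simps)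
      also have "\<dots> = (\<Prod>p\<in>Q. ?f p) * (\<Prod>p\<in>Q. 1 + (?g p)\<^sup>2)"
        by (rule prod.distrib)
      also have "\<dots> \<le> (G * (prod ?f (A Y) * prod ?f (B Y) * prod ?f (E Y))) * exp 2"
      proof (rule mult_mono)
        have sub: "Q \<subseteq> S \<union> (A Y \<union> B Y \<union> E Y)"
        proof
          fix p assume p: "p \<in> Q"
          show "p \<in> S \<union> (A Y \<union> B Y \<union> E Y)"
          proof (cases "p \<le> K")
            case False
            then have "odd p" using p gt2[of p] by (auto simp: Q_def prime_odd_nat)
            then have "p mod 4 = 1 \<or> p mod 4 = 3" by presburger
            then show ?thesis using p False by (auto simp: Q_def A_def B_def E_def)
          qed (use p in \<open>auto simp: Q_def S_def\<close>)
        qed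
        have "prod ?f Q \<le> prod ?f (S \<union> (A Y \<union> B Y \<union> E Y))"
          using sub finQ fin f1 by (intro prod_mono2) (auto intro: order_trans[OF zero_le_one])
        also have "\<dots> = prod ?f S * prod ?f (A Y \<union> B Y \<union> E Y)"
          using finQ fin by (intro prod.union_disjoint) (auto simp: S_def A_def B_def E_def)
        also have "prod ?f (A Y \<union> B Y \<union> E Y) = prod ?f (A Y) * prod ?f (B Y) * prod ?f (E Y)"
          using fin by (subst prod.union_disjoint; (subst prod.union_disjoint)?)
            (auto simp: A_def B_def E_def)
        also have "prod ?f S * (prod ?f (A Y) * prod ?f (B Y) * prod ?f (E Y))
          \<le> G * (prod ?f (A Y) * prod ?f (B Y) * prod ?f (E Y))"
        proof (rule mult_right_mono)
          have "prod ?f S \<le> (\<Prod>p\<in>S. 3)"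
          proof (intro prod_mono conjI)
            fix p assume "p \<in> S"
            then have "real p \<ge> 1" by (auto simp: S_def dest!: prime_ge_1_nat)
            then have "?g p \<le> real p powr 0" using s by (intro powr_mono) auto
            then show "?f p \<le> 3" using \<open>real p \<ge> 1\<close> by simp
          qed auto
          then show "prod ?f S \<le> G" by (simp add: G_def S_def)
        qed (use fpos in \<open>auto intro!: mult_nonneg_nonneg\<close>)
        finally show "prod ?f Q \<le> G * (prod ?f (A Y) * prod ?f (B Y) * prod ?f (E Y))" .
        have "(\<Prod>p\<in>Q. 1 + (?g p)\<^sup>2) \<le> exp (\<Sum>p\<in>Q. (?g p)\<^sup>2)"
          by (rule prod_le_exp_sum) auto
        also have "(\<Sum>p\<in>Q. (?g p)\<^sup>2) \<le> (\<Sum>p\<in>Q. 1 / (real p)\<^sup>2)"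
        proof (rule sum_mono)
          fix p assume "p \<in> Q"
          then have p: "real p \<ge> 1" by (auto simp: Q_def dest!: prime_ge_1_nat)
          then have "?g p \<le> real p powr - 1" using s by (intro powr_mono) auto
          then have "(?g p)\<^sup>2 \<le> (real p powr - 1)\<^sup>2" by (intro power_mono) auto
          then show "(?g p)\<^sup>2 \<le> 1 / (real p)\<^sup>2" using p by (simp add: powr_minus power_one_over field_simps)
        qed
        also have "\<dots> \<le> (\<Sum>n=1..Y. 1 / (real n)\<^sup>2)"
          by (intro sum_mono2) (auto simp: Q_def prime_ge_1_nat Suc_le_eq prime_gt_0_nat)
        also have "\<dots> \<le> 2" by (rule sum_inverse_squares_le)
        finally show "(\<Prod>p\<in>Q. 1 + (?g p)\<^sup>2) \<le> exp 2" by simp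
      qed (use Cpos fpos in \<open>auto intro!: prod_nonneg mult_nonneg_nonneg\<close>)
      finally show ?thesis by (simp add: mult_ac)
    qed
    obtain Y0 where Y0: "\<forall>p\<in>P. p \<le> Y0" using P(1) finite_nat_set_iff_bounded_le by auto
    \<comment> \<open>One more factor for \<open>B Y\<close> allows the regrouping B (A B E) = (A
      B)(B E), which is at most C1 C2 \<zeta>^2. In the limit of large \<open>Y\<close> the left
      side also contains \<zeta>^2, which cancels.\<close>
    have "prod ?f P * (Z Y)\<^sup>2 \<le> C * \<zeta>\<^sup>2" if "Y \<ge> Y0" for Y
    proof -
      have "prod ?f P \<le> prod ?f (B Y)"
        using P Y0 that fin f1 by (intro prod_mono2) (auto simp: B_def intro: order_trans[OF zero_le_one])
      then have "prod ?f P * (Z Y)\<^sup>2 \<le> prod ?f (B Y) * (4 * exp 2 * G * (prod ?f (A Y) * prod ?f (B Y) * prod ?f (E Y)))"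
        using ABE fpos by (intro mult_mono) auto
      also have "\<dots> = 4 * exp 2 * G * ((prod ?f (A Y) * prod ?f (B Y)) * (prod ?f (B Y) * prod ?f (E Y)))"
        by (simp add: mult_ac)
      also have "\<dots> \<le> 4 * exp 2 * G * ((C1 * \<zeta>) * (C2 * \<zeta>))"
        using AB BE fpos Cpos zpos by (intro mult_left_mono mult_mono[OF AB BE]) auto
      also have "\<dots> = C * \<zeta>\<^sup>2" by (simp add: C_def power2_eq_square mult_ac)
      finally show ?thesis .
    qed
    moreover have "(\<lambda>Y. prod ?f P * (Z Y)\<^sup>2) \<longlonglongrightarrow> prod ?f P * \<zeta>\<^sup>2"
      by (intro tendsto_intros Zlim)
    ultimately have "prod ?f P * \<zeta>\<^sup>2 \<le> C * \<zeta>\<^sup>2"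
      by (intro LIMSEQ_le_const2) auto
    then show ?thesis using zpos by simp
  qed
  show ?thesis
  proof (intro exI[of _ C] allI impI)
    fix P :: "nat set"
    assume P: "finite P" "P \<subseteq> {p. prime p \<and> K < p \<and> p mod 4 = 1 \<and> QuadRes (int p) \<Delta>}"
    \<comment> \<open>For a fixed finite \<open>P\<close> the bound passes to s = 1 by continuity,
      since its constant does not depend on \<open>s\<close>.\<close>
    have ev: "\<forall>\<^sub>F s in at_right 1. (\<Prod>p\<in>P. 1 + real p powr - s) \<le> C"
    proof -
      have "(\<Prod>p\<in>P. 1 + real p powr - s) \<le> C" if "s > 1" for s
        using bound[OF that P] by (rule order_trans[rotated]) (auto intro!: prod_mono)
      then show ?thesis by (auto simp: eventually_at_right_field intro: exI[of _ 2])
    qed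
    have "((\<lambda>s. \<Prod>p\<in>P. 1 + real p powr - s) \<longlongrightarrow> (\<Prod>p\<in>P. 1 + real p powr - 1)) (at_right 1)"
      using P(2) by (intro tendsto_intros) (auto simp: prime_gt_0_nat)
    from tendsto_upperbound[OF this ev] have "(\<Prod>p\<in>P. 1 + real p powr - 1) \<le> C" by simp
    then show "(\<Prod>p\<in>P. 1 + 1 / real p) \<le> C" by (simp add: powr_minus_divide)
  qed
qed

section \<open>Representations by the form x^2 + D y^2\<close>

text \<open>Modulo \<open>y\<close> the number \<open>n\<close> is x^2, and modulo \<open>x\<close>
  it is D y^2.\<close>

lemma coprime_norm_form:
  fixes x y n D :: int
  assumes n: "n = x\<^sup>2 + D * y\<^sup>2" and xy: "coprime x y" and nD: "coprime n D"
  shows "coprime n x" "coprime n y"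
proof -
  have "gcd n y = gcd (x\<^sup>2) y"
    unfolding n by (metis gcd.commute gcd_add_mult mult.assoc mult.commute power2_eq_square add.commute)
  then show "coprime n y" using xy by (simp add: coprime_iff_gcd_eq_1 flip: coprime_iff_gcd_eq_1)
  have "coprime x (D * y\<^sup>2)"
  proof (rule coprimeI)
    fix c assume c: "c dvd x" "c dvd D * y\<^sup>2"
    have "coprime c (y\<^sup>2)" using c(1) xy by (metis coprime_power_right_iff coprime_divisors dvd_refl)
    then have "c dvd D" using c(2) by (simp add: coprime_dvd_mult_left_iff)
    moreover have "c dvd n" unfolding n using c by (intro dvd_add) (auto simp: power2_eq_square)
    ultimately show "is_unit c" using nD by (meson coprime_common_divisor)
  qed
  moreover have "gcd n x = gcd (D * y\<^sup>2) x"
    unfolding n by (metis gcd.commute gcd_add_mult mult.commute power2_eq_square)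
  ultimately show "coprime n x" by (simp add: coprime_iff_gcd_eq_1 gcd.commute)
qed

text \<open>Each quotient x / y is a square root of -D modulo \<open>n\<close>. The root of (x1, y1)
  agrees with the reference root of (x0, y0) modulo \<open>u = gcd n (x1 * y0 - x0 * y1)\<close> and
  is its negative modulo n / u, so \<open>u\<close> determines it. Two positive representations with
  the same root coincide by size.\<close>

lemma representation_determined_by_gcd:
  fixes D n x0 y0 x1 y1 x2 y2 :: int
  assumes D: "D > 0" and nD: "coprime n (2 * D)"
    and n: "n = x0\<^sup>2 + D * y0\<^sup>2" "n = x1\<^sup>2 + D * y1\<^sup>2" "n = x2\<^sup>2 + D * y2\<^sup>2"
    and pos: "x1 > 0" "y1 > 0" "x2 > 0" "y2 > 0"
    and cop: "coprime x0 y0" "coprime x1 y1" "coprime x2 y2"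
    and g: "gcd n (x1 * y0 - x0 * y1) = gcd n (x2 * y0 - x0 * y2)"
  shows "x1 = x2 \<and> y1 = y2"
proof -
  have nD': "coprime n D" "coprime n 2" using nD by auto
  have n0: "n > 0" using n(2) D pos by (auto intro: add_pos_pos)
  define u where "u = gcd n (x1 * y0 - x0 * y1)"
  obtain v where v: "n = u * v" unfolding u_def by (metis dvdE gcd_dvd1)
  \<comment> \<open>\<open>n\<close> divides d e, where d and e are the difference and the sum of
    the cross products. A common factor of \<open>u\<close> and \<open>v\<close> would divide d + e
    = 2 x y0, which is coprime to \<open>n\<close>.\<close>
  have *: "v dvd x * y0 + x0 * y \<and> coprime u v"
    if x: "n = x\<^sup>2 + D * y\<^sup>2" "coprime x y" "gcd n (x * y0 - x0 * y) = u" for x y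
  proof -
    define d where "d = x * y0 - x0 * y"
    define e where "e = x * y0 + x0 * y"
    have "d * e = (x\<^sup>2 + D * y\<^sup>2) * y0\<^sup>2 - (x0\<^sup>2 + D * y0\<^sup>2) * y\<^sup>2"
      by (simp add: d_def e_def power2_eq_square algebra_simps)
    also have "\<dots> = n * (y0\<^sup>2 - y\<^sup>2)"
      unfolding x(1)[symmetric] n(1)[symmetric] by (simp add: algebra_simps)
    finally have "n dvd d * e" by simp
    obtain d' where d': "d = u * d'" using x(3) by (metis d_def dvdE gcd_dvd2)
    have u0: "u \<noteq> 0" using v n0 by auto
    have "gcd (u * v) (u * d') = u" using x(3) v d' d_def by simp
    then have "\<bar>u\<bar> * gcd v d' = u" by (simp add: gcd_mult_left abs_mult)
    then have "gcd v d' = 1" using u0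
      by (metis abs_if gcd_ge_0_int mult_cancel_left1 mult_minus_left neg_equal_iff_equal mult_minus_right abs_of_nonneg mult_eq_0_iff x(3))
    moreover have "v dvd d' * e" using \<open>n dvd d * e\<close> u0 unfolding v d' by (simp add: mult.assoc)
    ultimately have "v dvd e" by (simp add: coprime_dvd_mult_right_iff coprime_iff_gcd_eq_1)
    moreover have "coprime u v"
    proof (rule coprimeI)
      fix c assume c: "c dvd u" "c dvd v"
      have cn: "c dvd n" using c v by simp
      have "c dvd d + e" using c d' \<open>v dvd e\<close> by (intro dvd_add) (auto intro: dvd_trans)
      also have "d + e = 2 * x * y0" by (simp add: d_def e_def)
      finally have "c dvd 2 * x * y0" .
      moreover have "coprime n (2 * x * y0)"
        using coprime_norm_form[OF x(1,2) nD'(1)] coprime_norm_form[OF n(1) cop(1) nD'(1)] nD'(2) by simp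
      ultimately show "is_unit c" using cn by (meson coprime_common_divisor)
    qed
    ultimately show ?thesis by (simp add: e_def)
  qed
  note a = *[OF n(2) cop(2) u_def[symmetric]] and b = *[OF n(3) cop(3) g[symmetric, folded u_def]]
  define w where "w = x1 * y2 - x2 * y1"
  have ny0: "coprime n y0" using coprime_norm_form[OF n(1) cop(1) nD'(1)] by simp
  have "u dvd x1 * y0 - x0 * y1" "u dvd x2 * y0 - x0 * y2"
    unfolding u_def by (rule gcd_dvd2, simp add: g)
  then have "u dvd (x1 * y0 - x0 * y1) * y2 - (x2 * y0 - x0 * y2) * y1" by simp
  also have "(x1 * y0 - x0 * y1) * y2 - (x2 * y0 - x0 * y2) * y1 = w * y0"
    by (simp add: w_def algebra_simps)
  finally have "u dvd w * y0" .
  moreover have "coprime u y0" using ny0 v by simp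
  ultimately have uw: "u dvd w" by (simp add: coprime_dvd_mult_left_iff)
  have "v dvd (x1 * y0 + x0 * y1) * y2 - (x2 * y0 + x0 * y2) * y1" using a b by simp
  also have "(x1 * y0 + x0 * y1) * y2 - (x2 * y0 + x0 * y2) * y1 = w * y0"
    by (simp add: w_def algebra_simps)
  finally have "v dvd w * y0" .
  moreover have "coprime v y0" using ny0 v by simp
  ultimately have "v dvd w" by (simp add: coprime_dvd_mult_left_iff)
  then have nw: "n dvd w" unfolding v using uw a by (intro divides_mult) auto
  \<comment> \<open>All squares involved are below \<open>n\<close>, so each cross product lies
    strictly between 0 and \<open>n\<close>. Hence |w| < n, and the multiple \<open>w\<close> of
    \<open>n\<close> is 0.\<close>
  have lt: "0 < x * y' \<and> x * y' < n"
    if "n = x\<^sup>2 + D * y\<^sup>2" "n = x'\<^sup>2 + D * y'\<^sup>2" "x > 0" "y > 0" "x' > 0" "y' > 0" for x y x' y' :: int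
  proof -
    have "D * y\<^sup>2 > 0" using D that by simp
    then have "x\<^sup>2 < n" using that by linarith
    moreover have "y'\<^sup>2 \<le> D * y'\<^sup>2" using D by (simp add: mult_le_cancel_right1)
    then have "y'\<^sup>2 < n" using that zero_less_power[of x' 2] by linarith
    ultimately have "x\<^sup>2 * y'\<^sup>2 < n * n" using n0 by (intro mult_strict_mono) auto
    then have "(x * y')\<^sup>2 < n\<^sup>2" by (simp add: power2_eq_square mult_ac)
    then have "x * y' < n" using n0 by (meson less_imp_le power2_less_imp_less)
    then show ?thesis using that by simp
  qed
  have "\<bar>w\<bar> < n" using lt[OF n(2,3) pos] lt[OF n(3,2) pos(3,4,1,2)] unfolding w_def by linarith
  then have "w = 0" using nw dvd_imp_le_int[of w n] by fastforce
  then have e: "x1 * y2 = x2 * y1" by (simp add: w_def)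
  then have "x1 dvd x2 * y1" "x2 dvd x1 * y2" by (metis dvd_triv_left)+
  then have "x1 dvd x2" "x2 dvd x1" using cop by (simp_all add: coprime_dvd_mult_left_iff)
  then have "x1 = x2" using pos by (simp add: zdvd_antisym_nonneg)
  then show ?thesis using e pos by simp
qed

lemma harmonic_unbounded: "\<exists>N. C < (\<Sum>i=1..N. 1 / real i)"
proof (rule ccontr)
  assume h: "\<not> ?thesis"
  have "summable (\<lambda>i. inverse (real i))"
  proof (rule summableI_nonneg_bounded[of _ C])
    fix n
    have "(\<Sum>i<n. inverse (real i)) \<le> (\<Sum>i=1..n. 1 / real i)"
    proof -
      have "(\<Sum>i<n. inverse (real i)) = (\<Sum>i\<in>{1..<n}. inverse (real i))"
        by (intro sum.mono_neutral_right) (auto simp: Suc_le_eq)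
      also have "\<dots> \<le> (\<Sum>i=1..n. inverse (real i))" by (intro sum_mono2) auto
      finally show ?thesis by (simp add: inverse_eq_divide)
    qed
    also have "\<dots> \<le> C" using h by (meson not_le)
    finally show "(\<Sum>i<n. inverse (real i)) \<le> C" .
  qed auto
  then show False using not_summable_harmonic by blast
qed

text \<open>The pairs x = 1 + K i, y = K j with 1 \<le> j \<le> i satisfy the conditions. Each
  \<open>i\<close> gives \<open>i\<close> terms of size at least 1 / (M i^2), where \<open>M\<close>
  comes from 1 + K i \<le> 2 K i; a harmonic sum remains.\<close>

lemma norm_form_reciprocal_sum_unbounded:
  fixes D K :: nat
  assumes K: "K > 0"
  shows "\<exists>X. c < (\<Sum>(x, y) | x \<in> {1..X} \<and> y \<in> {1..X} \<and> coprime x K \<and> K dvd y. 1 / real (x\<^sup>2 + D * y\<^sup>2))"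
proof -
  define M where "M = 4 * (1 + real D) * (real K)\<^sup>2"
  have M: "M > 0" using K by (simp add: M_def)
  obtain N where N: "c * M < (\<Sum>i=1..N. 1 / real i)" using harmonic_unbounded by blast
  define X where "X = 1 + K * N"
  define S where "S = {(x, y). x \<in> {1..X} \<and> y \<in> {1..X} \<and> coprime x K \<and> K dvd y}"
  define J where "J = (SIGMA i:{1..N}. {1..i})"
  define \<phi> where "\<phi> = (\<lambda>(i, j). (1 + K * i, K * j))"
  define F where "F = (\<lambda>(x::nat, y::nat). 1 / real (x\<^sup>2 + D * y\<^sup>2))"
  have "c * M < (\<Sum>i=1..N. 1 / real i)" by (rule N)
  also have "\<dots> = (\<Sum>i=1..N. \<Sum>j=1..i. 1 / (real i)\<^sup>2)"
    by (intro sum.cong) (auto simp: power2_eq_square field_simps)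
  also have "\<dots> = (\<Sum>(i, j)\<in>J. 1 / (real i)\<^sup>2)"
    unfolding J_def by (intro sum.Sigma) auto
  also have "\<dots> \<le> (\<Sum>ij\<in>J. M * F (\<phi> ij))"
  proof (intro sum_mono, clarify)
    fix i j assume ij: "(i, j) \<in> J"
    then have i: "1 \<le> i" "1 \<le> j" "j \<le> i" by (auto simp: J_def)
    have "(1 + K * i)\<^sup>2 + D * (K * j)\<^sup>2 \<le> (2 * K * i)\<^sup>2 + D * (2 * K * i)\<^sup>2"
      using i K by (intro add_mono mult_left_mono power_mono) (auto simp: Suc_le_eq mult_le_mono intro: le_trans[of _ "K * i"])
    then have "real ((1 + K * i)\<^sup>2 + D * (K * j)\<^sup>2) \<le> real ((2 * K * i)\<^sup>2 + D * (2 * K * i)\<^sup>2)"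
      by (simp only: of_nat_le_iff)
    also have "\<dots> = M * (real i)\<^sup>2" by (simp add: M_def power_mult_distrib algebra_simps)
    finally have le: "real ((1 + K * i)\<^sup>2 + D * (K * j)\<^sup>2) \<le> M * (real i)\<^sup>2" .
    have "0 < (1 + K * i)\<^sup>2 + D * (K * j)\<^sup>2" by simp
    then have pos: "0 < real ((1 + K * i)\<^sup>2 + D * (K * j)\<^sup>2)" by (simp only: of_nat_0_less_iff)
    have "1 / (real i)\<^sup>2 = M * (1 / (M * (real i)\<^sup>2))" using M by simp
    also have "\<dots> \<le> M * (1 / real ((1 + K * i)\<^sup>2 + D * (K * j)\<^sup>2))"
      using le M i pos by (intro mult_left_mono divide_left_mono mult_pos_pos) (simp_all only: zero_le_one less_imp_le, simp_all)
    finally show "1 / (real i)\<^sup>2 \<le> M * F (\<phi> (i, j))" by (simp add: F_def \<phi>_def)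
  qed
  also have "\<dots> = M * (\<Sum>ij\<in>J. F (\<phi> ij))" by (simp add: sum_distrib_left)
  also have "(\<Sum>ij\<in>J. F (\<phi> ij)) = (\<Sum>z\<in>\<phi> ` J. F z)"
    using K by (subst sum.reindex) (auto simp: inj_on_def \<phi>_def)
  also have "M * \<dots> \<le> M * (\<Sum>z\<in>S. F z)"
  proof (intro mult_left_mono sum_mono2)
    show "\<phi> ` J \<subseteq> S"
    proof
      fix z assume "z \<in> \<phi> ` J"
      then obtain i j where z: "z = \<phi> (i, j)" and "(i, j) \<in> J" by force
      then have i: "1 \<le> i" "1 \<le> j" "j \<le> i" "i \<le> N" by (auto simp: J_def)
      have le: "K * i \<le> K * N" "K * j \<le> K * N" using i by auto
      have "coprime (1 + K * i) K"
      proof (rule coprimeI)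
        fix c assume c: "c dvd 1 + K * i" "c dvd K"
        then have "c dvd K * i" by simp
        then show "is_unit c" using c(1) by (metis dvd_add_left_iff)
      qed
      then have "coprime (1 + K * i) K \<and> K dvd K * j" by simp
      moreover have "1 \<le> K * j" using i K by simp
      moreover have "1 + K * i \<le> X" "K * j \<le> X" using le unfolding X_def by linarith+
      ultimately show "z \<in> S" by (simp add: z S_def \<phi>_def)
    qed
    have "S \<subseteq> {1..X} \<times> {1..X}" by (auto simp: S_def)
    then show "finite S" by (rule finite_subset) auto
  qed (use M in \<open>auto simp: F_def\<close>)
  finally have "c < (\<Sum>z\<in>S. F z)" using M by (simp add: mult.commute)
  then show ?thesis unfolding S_def F_def by (intro exI[of _ X]) (simp add: case_prod_unfold)
qed

text \<open>If the claim fails, the values of x^2 + \<Delta> y^2 at suitable coprime pairs have only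
  prime factors in \<open>\<B>\<close>, and numbers composed of such primes have reciprocal sum at
  most 2C. A coprime representation is determined by a factorization of its value into two such
  numbers, so the reciprocals of all values sum to at most 8 C^2, against their divergence.\<close>

lemma infinitely_many_3_mod_4_divisors:
  fixes \<Delta> :: int and K :: nat
  assumes pos: "\<Delta> > 0" and nsq: "\<not> (\<exists>z. \<Delta> = z\<^sup>2)"
  shows "\<exists>p>K. prime p \<and> p mod 4 = 3 \<and> QuadRes (int p) (- \<Delta>)"
proof (rule ccontr)
  assume contra: "\<not> ?thesis"
  have nsq': "y = 0" if h: "x\<^sup>2 = \<Delta> * y\<^sup>2" for x y
  proof (rule ccontr)
    assume y: "y \<noteq> 0"
    have "y\<^sup>2 dvd x\<^sup>2" using h by simp
    then have "y dvd x" by simp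
    then obtain z where "x = y * z" by (elim dvdE)
    then have "\<Delta> = z\<^sup>2" using h y by (simp add: power_mult_distrib)
    then show False using nsq by blast
  qed
  define D where "D = nat \<Delta>"
  have D: "D > 0" "int D = \<Delta>" using pos by (simp_all add: D_def)
  define k where "k = K + D + 3"
  define \<B> where "\<B> = {p. prime p \<and> k < p \<and> p mod 4 = 1 \<and> QuadRes (int p) \<Delta>}"
  have "\<exists>C. \<forall>P. finite P \<longrightarrow> P \<subseteq> \<B> \<longrightarrow> (\<Prod>p\<in>P. 1 + 1 / real p) \<le> C"
    unfolding \<B>_def
  proof (rule prod_common_split_primes_bounded[OF pos nsq'])
    fix p assume "prime p" "p > k" "p mod 4 = 3"
    then show "\<not> QuadRes (int p) (- \<Delta>)" using contra by (auto simp: k_def)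
  qed (auto simp: k_def D_def)
  then obtain C where C: "\<And>P. finite P \<Longrightarrow> P \<subseteq> \<B> \<Longrightarrow> (\<Prod>p\<in>P. 1 + 1 / real p) \<le> C" by blast
  \<comment> \<open>With \<open>x\<close> coprime to \<open>L\<close> and \<open>y\<close> divisible
    by \<open>L\<close>, the value is coprime to \<open>L\<close>, hence to \<open>2 * D\<close> and
    to every prime up to \<open>k\<close>.\<close>
  define L :: nat where "L = fact k"
  have L: "L > 0" by (simp add: L_def)
  define n where "n = (\<lambda>(x, y). x\<^sup>2 + D * y\<^sup>2 :: nat)"
  obtain X where X: "8 * C\<^sup>2 < (\<Sum>(x, y) | x \<in> {1..X} \<and> y \<in> {1..X} \<and> coprime x L \<and> L dvd y. 1 / real (x\<^sup>2 + D * y\<^sup>2))"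
    using norm_form_reciprocal_sum_unbounded[OF L] by blast
  define S where "S = {(x, y). x \<in> {1..X} \<and> y \<in> {1..X} \<and> coprime x L \<and> L dvd y}"
  define T where "T = {(x, y). (x, y) \<in> S \<and> coprime x y}"
  define N where "N = X\<^sup>2 + D * X\<^sup>2"
  define P where "P = {p \<in> \<B>. p \<le> N}"
  define U where "U = {u \<in> {1..N}. \<forall>p. prime p \<longrightarrow> p dvd u \<longrightarrow> p \<in> P}"
  have "S \<subseteq> {1..X} \<times> {1..X}" by (auto simp: S_def)
  then have finS: "finite S" by (rule finite_subset) auto
  have "T \<subseteq> S" by (auto simp: T_def)
  then have finT: "finite T" using finS by (rule finite_subset)
  have npos: "n z > 0" if "z \<in> S" for z using that by (auto simp: S_def n_def)
  have nN: "n z \<le> N" if "z \<in> S" for z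
    using that unfolding n_def N_def S_def by (auto intro!: add_mono mult_left_mono power_mono)
  have copL: "coprime (n z) L" if z: "z \<in> S" for z
  proof -
    obtain x y where e: "z = (x, y)" "coprime x L" "L dvd y" using z by (auto simp: S_def)
    show ?thesis
    proof (rule coprimeI)
      fix c assume c: "c dvd n z" "c dvd L"
      then have "c dvd y" using e by auto
      then have "c dvd D * y\<^sup>2" by (simp add: power2_eq_square)
      then have "c dvd x\<^sup>2" using c(1) e by (simp add: n_def dvd_add_left_iff)
      moreover have "coprime (x\<^sup>2) L" using e by simp
      ultimately show "is_unit c" using c(2) by (meson coprime_common_divisor)
    qed
  qed
  have copD: "coprime (n z) (2 * D)" if "z \<in> S" for z
  proof -
    have "2 dvd L" "D dvd L" unfolding L_def using D by (auto simp: k_def intro!: dvd_fact)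
    then have "coprime (n z) 2" "coprime (n z) D"
      using copL[OF that] by (auto intro: coprime_divisors[OF dvd_refl])
    then show ?thesis by simp
  qed
  \<comment> \<open>Here \<open>- \<Delta>\<close> is a residue modulo \<open>p\<close>, which by
    \<open>contra\<close> forces \<open>p\<close> to be 1 mod 4. Then -1 is a residue too, and so is
    \<open>\<Delta>\<close>.\<close>
  have primes_in: "p \<in> P" if z: "z \<in> T" and p: "prime p" "p dvd n z" for z p
  proof -
    obtain x y where e: "z = (x, y)" "coprime x y" "z \<in> S" using z by (auto simp: T_def)
    have big: "p > k"
    proof (rule ccontr)
      assume "\<not> p > k"
      then have "p dvd L" using p by (simp add: L_def prime_dvd_fact_iff)
      then show False using copL[OF e(3)] p by (meson coprime_common_divisor not_prime_unit)
    qed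
    have d: "int p dvd (int x)\<^sup>2 + \<Delta> * (int y)\<^sup>2"
    proof -
      have "int (n z) = (int x)\<^sup>2 + \<Delta> * (int y)\<^sup>2" by (simp add: e n_def flip: D(2))
      then show ?thesis using p(2) by (metis of_nat_dvd_iff)
    qed
    have "\<not> p dvd y"
    proof
      assume y: "p dvd y"
      then have "p dvd D * y\<^sup>2" by (simp add: power2_eq_square)
      then have "p dvd x\<^sup>2" using p(2) e by (simp add: n_def dvd_add_left_iff)
      then have "p dvd x" using p(1) prime_dvd_power by blast
      then show False using y e(2) p(1) by (meson coprime_common_divisor not_prime_unit)
    qed
    then have res: "QuadRes (int p) (- \<Delta>)"
      using d p(1) by (intro QuadRes_quotient[where x = "int x" and y = "int y"]) auto
    then have "p mod 4 \<noteq> 3" using contra big p(1) by (auto simp: k_def)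
    moreover have "odd p" using big p(1) by (simp add: k_def prime_odd_nat)
    ultimately have p1: "p mod 4 = 1" by presburger
    have gt2: "2 < p" using big by (simp add: k_def)
    have "\<not> int p dvd \<Delta>" using big pos D zdvd_imp_le[of "int p" \<Delta>] by (auto simp: k_def)
    then have "QuadRes (int p) \<Delta>"
      using QuadRes_mult_iff[OF p(1) gt2, of "-1" \<Delta>] QuadRes_minus_one_iff[OF p(1) gt2] p1 res gt2
      by auto
    moreover have "p \<le> N" using dvd_imp_le[OF p(2) npos[OF e(3)]] nN[OF e(3)] by simp
    ultimately show ?thesis using p(1) big p1 by (simp add: P_def \<B>_def)
  qed
  have sumU: "(\<Sum>u\<in>U. 1 / real u) \<le> 2 * C"
  proof -
    have "(\<Sum>u\<in>U. 1 / real u) = (\<Sum>u | u \<in> {1..N} \<and> (\<forall>p. prime p \<longrightarrow> p dvd u \<longrightarrow> p \<in> P). real u powr - 1)"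
      unfolding U_def by (intro sum.cong) (auto simp: powr_minus_divide)
    also have "\<dots> \<le> 2 * (\<Prod>p\<in>P. 1 + real p powr - 1)"
      by (intro sum_powr_smooth_le) (auto simp: P_def)
    also have "(\<Prod>p\<in>P. 1 + real p powr - 1) = (\<Prod>p\<in>P. 1 + 1 / real p)"
      by (intro prod.cong) (auto simp: powr_minus_divide)
    also have "2 * \<dots> \<le> 2 * C" using C[of P] by (auto simp: P_def)
    finally show ?thesis .
  qed
  \<comment> \<open>One reference representation for each attained value, shared by all
    representations of that value, as \<open>representation_determined_by_gcd\<close>
    requires.\<close>
  define rep where "rep m = (SOME z. z \<in> T \<and> n z = m)" for m
  have rep: "rep (n z) \<in> T" "n (rep (n z)) = n z" if "z \<in> T" for z
    using someI[of "\<lambda>w. w \<in> T \<and> n w = n z" z] that by (auto simp: rep_def)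
  define g where "g z = nat (gcd (int (n z))
      (int (fst z) * int (snd (rep (n z))) - int (fst (rep (n z))) * int (snd z)))" for z
  have gdvd: "g z dvd n z" for z
  proof -
    have "int (g z) dvd int (n z)" by (simp add: g_def)
    then show ?thesis by (simp only: of_nat_dvd_iff)
  qed
  define \<phi> where "\<phi> z = (g z, n z div g z)" for z
  have prod\<phi>: "fst (\<phi> z) * snd (\<phi> z) = n z" for z using gdvd by (simp add: \<phi>_def)
  have inj: "inj_on \<phi> T"
  proof (rule inj_onI)
    fix z1 z2 assume z: "z1 \<in> T" "z2 \<in> T" "\<phi> z1 = \<phi> z2"
    have nn: "n z1 = n z2" using z(3) prod\<phi> by metis
    define m where "m = n z1"
    obtain x1 y1 where e1: "z1 = (x1, y1)" by force
    obtain x2 y2 where e2: "z2 = (x2, y2)" by force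
    obtain x0 y0 where e0: "rep m = (x0, y0)" by force
    have r: "(x0, y0) \<in> T" "n (x0, y0) = m" using rep[OF z(1)] e0 by (auto simp: m_def)
    have in_S: "(x0, y0) \<in> S" "(x1, y1) \<in> S" "(x2, y2) \<in> S" using r z e1 e2 by (auto simp: T_def)
    have m: "m = n (x0, y0)" "m = n (x1, y1)" "m = n (x2, y2)" using r nn m_def e1 e2 by auto
    have "g z1 = g z2" using z(3) by (simp add: \<phi>_def)
    moreover have n12: "n z1 = m" "n z2 = m" using nn by (simp_all add: m_def)
    have "int (g z1) = gcd (int m) (int x1 * int y0 - int x0 * int y1)"
      unfolding g_def n12 e0 by (simp add: e1)
    moreover have "int (g z2) = gcd (int m) (int x2 * int y0 - int x0 * int y2)"
      unfolding g_def n12 e0 by (simp add: e2)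
    ultimately have gg: "gcd (int m) (int x1 * int y0 - int x0 * int y1) = gcd (int m) (int x2 * int y0 - int x0 * int y2)"
      by simp
    have "int x1 = int x2 \<and> int y1 = int y2"
    proof (rule representation_determined_by_gcd[of "int D" "int m" "int x0" "int y0"])
      show "coprime (int m) (2 * int D)" using copD[OF in_S(1)] m(1)
        by (metis coprime_int_iff of_nat_mult of_nat_numeral)
      show "int m = (int x0)\<^sup>2 + int D * (int y0)\<^sup>2"
        by (subst m(1)) (simp add: n_def)
      show "int m = (int x1)\<^sup>2 + int D * (int y1)\<^sup>2"
        by (subst m(2)) (simp add: n_def)
      show "int m = (int x2)\<^sup>2 + int D * (int y2)\<^sup>2"
        by (subst m(3)) (simp add: n_def)
      show "coprime (int x0) (int y0)" "coprime (int x1) (int y1)" "coprime (int x2) (int y2)"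
        using r z e1 e2 by (auto simp: T_def)
    qed (use in_S D gg in \<open>auto simp: S_def\<close>)
    then show "z1 = z2" using e1 e2 by simp
  qed
  have img: "\<phi> ` T \<subseteq> U \<times> U"
  proof
    fix w assume "w \<in> \<phi> ` T"
    then obtain z where z: "z \<in> T" "w = \<phi> z" by auto
    have zS: "z \<in> S" using z \<open>T \<subseteq> S\<close> by auto
    have "u \<in> U" if "u dvd n z" for u
      using that dvd_imp_le[OF that npos[OF zS]] nN[OF zS] dvd_pos_nat[OF npos[OF zS] that]
        primes_in[OF z(1)] by (auto simp: U_def intro: dvd_trans)
    moreover have "fst w dvd n z" "snd w dvd n z" using prod\<phi>[of z] z by (metis dvd_triv_left, metis dvd_triv_right)
    ultimately show "w \<in> U \<times> U" by (cases w) auto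
  qed
  have sumT: "(\<Sum>z\<in>T. 1 / real (n z)) \<le> (2 * C)\<^sup>2"
  proof -
    have "(\<Sum>z\<in>T. 1 / real (n z)) = (\<Sum>z\<in>T. (1 / real (fst (\<phi> z))) * (1 / real (snd (\<phi> z))))"
      by (intro sum.cong) (simp_all flip: prod\<phi>)
    also have "\<dots> = (\<Sum>w\<in>\<phi> ` T. (1 / real (fst w)) * (1 / real (snd w)))"
      using inj by (simp add: sum.reindex)
    also have "\<dots> \<le> (\<Sum>w\<in>U \<times> U. (1 / real (fst w)) * (1 / real (snd w)))"
      using img by (intro sum_mono2) (auto simp: U_def)
    also have "\<dots> = (\<Sum>u\<in>U. 1 / real u)\<^sup>2"
      by (simp add: power2_eq_square sum_product sum.cartesian_product case_prod_unfold)
    also have "\<dots> \<le> (2 * C)\<^sup>2" using sumU by (intro power_mono sum_nonneg) auto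
    finally show ?thesis .
  qed
  \<comment> \<open>A general pair is \<open>c\<close> times a coprime pair, which divides the
    reciprocal by c^2; summing over \<open>c\<close> costs a factor of at most 2. The coprime pair
    is in \<open>T\<close> because \<open>c\<close> is coprime to \<open>L\<close>.\<close>
  have "(\<Sum>z\<in>S. 1 / real (n z)) \<le> (\<Sum>(c, z)\<in>{1..X} \<times> T. 1 / (real c)\<^sup>2 * (1 / real (n z)))"
  proof (rule sum_le_included[where i = "\<lambda>(c, x, y). (c * x, c * y)"])
    show "\<forall>z\<in>S. \<exists>w\<in>{1..X} \<times> T. (case w of (c, x, y) \<Rightarrow> (c * x, c * y)) = z \<and>
      1 / real (n z) \<le> (case w of (c, z) \<Rightarrow> 1 / (real c)\<^sup>2 * (1 / real (n z)))"
    proof clarify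
      fix x y assume xy: "(x, y) \<in> S"
      then have b: "1 \<le> x" "x \<le> X" "1 \<le> y" "y \<le> X" "coprime x L" "L dvd y" by (auto simp: S_def)
      obtain x' y' where c: "x = gcd x y * x'" "y = gcd x y * y'" "coprime x' y'"
        using gcd_coprime_exists[of x y] b by (auto simp: mult.commute)
      define c where "c = gcd x y"
      have c': "x = c * x'" "y = c * y'" using c by (simp_all add: c_def)
      have "c \<ge> 1" using b c' by (metis One_nat_def Suc_leI mult_is_0 not_gr_zero not_one_le_zero)
      moreover have "c \<le> X" using b(1,2) gcd_le1_nat[of x y] unfolding c_def by linarith
      moreover have "(x', y') \<in> T"
      proof -
        have "coprime c L" "coprime x' L" using b(5) unfolding c'(1) by auto
        then have "L dvd y'" using b(6) unfolding c'(2)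
          by (simp add: coprime_dvd_mult_right_iff coprime_commute)
        moreover have "1 \<le> x'" "1 \<le> y'" using b(1,3) unfolding c' by auto
        moreover have "x' \<le> X" "y' \<le> X" proof -
          have "x' \<le> c * x'" "y' \<le> c * y'" using \<open>c \<ge> 1\<close> by simp_all
          then show "x' \<le> X" "y' \<le> X" using b(2,4) c' by linarith+
        qed
        ultimately show ?thesis using c(3) \<open>coprime x' L\<close> by (simp add: T_def S_def)
      qed
      moreover have "1 / real (n (x, y)) = 1 / (real c)\<^sup>2 * (1 / real (n (x', y')))"
        unfolding c' by (simp add: n_def power_mult_distrib algebra_simps)
      ultimately show "\<exists>w\<in>{1..X} \<times> T. (case w of (c, x, y) \<Rightarrow> (c * x, c * y)) = (x, y) \<and>
        1 / real (n (x, y)) \<le> (case w of (c, z) \<Rightarrow> 1 / (real c)\<^sup>2 * (1 / real (n z)))"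
        using c' by (intro bexI[of _ "(c, x', y')"]) auto
    qed
  qed (use finS finT in auto)
  also have "\<dots> = (\<Sum>c=1..X. 1 / (real c)\<^sup>2) * (\<Sum>z\<in>T. 1 / real (n z))"
    by (simp add: sum_product sum.cartesian_product)
  also have "\<dots> \<le> 2 * (2 * C)\<^sup>2"
    using sumT sum_inverse_squares_le by (intro mult_mono sum_nonneg) auto
  finally have "(\<Sum>z\<in>S. 1 / real (n z)) \<le> 8 * C\<^sup>2" by (simp add: power_mult_distrib)
  moreover have "8 * C\<^sup>2 < (\<Sum>z\<in>S. 1 / real (n z))"
    using X by (simp add: S_def n_def case_prod_unfold)
  ultimately show False by simp
qed

section \<open>Local conditions\<close>

lemma coprime_int_prime:
  assumes "prime p" "\<not> int p dvd a"
  shows "coprime a (int p)"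
  using assms prime_imp_coprime[of "int p" a] by (simp add: coprime_commute)

section \<open>Excluding values by primes that are 3 mod 4\<close>

lemma not_sum_of_two_squares:
  assumes p: "prime p" "p mod 4 = 3" and d: "p dvd n" "\<not> p\<^sup>2 dvd n"
  shows "n \<notin> sums_two_squares"
proof
  assume "n \<in> sums_two_squares"
  then obtain m l where n: "n = m\<^sup>2 + l\<^sup>2" by (auto simp: sums_two_squares_def)
  then have "int p dvd (int m)\<^sup>2 + (int l)\<^sup>2"
    using d(1) by (metis of_nat_add of_nat_dvd_iff of_nat_power)
  from prime_3_mod_4_dvd_sum_squares[OF p this] have "p dvd m" "p dvd l" by simp_all
  then have "p\<^sup>2 dvd n" unfolding n by (intro dvd_add dvd_power_same)
  then show False using d(2) by simp
qed

text \<open>Induction over \<open>G\<close>: each new \<open>\<Delta>\<close> receives its own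
  prime, larger than the modulus so far, and a congruence for \<open>T\<close> modulo the square of
  that prime. The Chinese remainder theorem joins it to the earlier ones.\<close>

lemma progression_avoiding_sums_of_two_squares:
  fixes G :: "int set" and W :: nat and c :: int
  assumes "finite G" "\<And>\<Delta>. \<Delta> \<in> G \<Longrightarrow> \<Delta> > 0 \<and> \<not> (\<exists>z. \<Delta> = z\<^sup>2)" "W > 0"
  shows "\<exists>W' c'. W' > 0 \<and> W dvd W' \<and> [c' = c] (mod int W) \<and>
    (\<forall>T. [T = c'] (mod int W') \<longrightarrow> (\<forall>\<Delta>\<in>G. \<exists>p. prime p \<and> p mod 4 = 3 \<and> \<not> p dvd W \<and>
      int p dvd T\<^sup>2 + \<Delta> \<and> \<not> (int p)\<^sup>2 dvd T\<^sup>2 + \<Delta>))"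
  using assms(1,2)
proof (induction G rule: finite_induct)
  case empty
  then show ?case using assms(3) by (intro exI[of _ W] exI[of _ c]) auto
next
  case (insert \<Delta> G)
  then obtain W' c' where W': "W' > 0" "W dvd W'" "[c' = c] (mod int W)"
    "\<And>T \<Delta>. [T = c'] (mod int W') \<Longrightarrow> \<Delta> \<in> G \<Longrightarrow> \<exists>p. prime p \<and> p mod 4 = 3 \<and> \<not> p dvd W \<and>
      int p dvd T\<^sup>2 + \<Delta> \<and> \<not> (int p)\<^sup>2 dvd T\<^sup>2 + \<Delta>" by (metis insertCI)
  have \<Delta>: "\<Delta> > 0" "\<not> (\<exists>z. \<Delta> = z\<^sup>2)" using insert.prems by auto
  obtain p where p: "p > W' + nat \<Delta>" "prime p" "p mod 4 = 3" "QuadRes (int p) (- \<Delta>)"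
    using infinitely_many_3_mod_4_divisors[OF \<Delta>] by blast
  have pW: "\<not> p dvd W'" using p(1) W'(1) by (auto dest: dvd_imp_le)
  have p2: "2 < p" using p(2,3) prime_ge_2_nat[of p] by (cases "p = 2") auto
  obtain z where z: "int p dvd z\<^sup>2 + \<Delta>" using p(4) by (auto simp: QuadRes_def cong_iff_dvd_diff)
  have "\<not> int p dvd \<Delta>" using p(1) \<Delta>(1) zdvd_imp_le[of "int p" \<Delta>] by auto
  then have pz: "\<not> int p dvd z" using z by (metis dvd_add_right_iff dvd_mult power2_eq_square)
  \<comment> \<open>If p^2 divides z^2 + \<Delta>, then \<open>z + int p\<close> serves instead: the
    value changes by p (2z + p), and \<open>p\<close> does not divide 2z.\<close>
  obtain z' where z': "int p dvd z'\<^sup>2 + \<Delta>" "\<not> (int p)\<^sup>2 dvd z'\<^sup>2 + \<Delta>"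
  proof (cases "(int p)\<^sup>2 dvd z\<^sup>2 + \<Delta>")
    case False
    then show ?thesis using z that by blast
  next
    case True
    have e: "(z + int p)\<^sup>2 + \<Delta> = (z\<^sup>2 + \<Delta>) + int p * (2 * z + int p)"
      by (simp add: power2_eq_square algebra_simps)
    have "\<not> (int p)\<^sup>2 dvd (z + int p)\<^sup>2 + \<Delta>"
    proof
      assume "(int p)\<^sup>2 dvd (z + int p)\<^sup>2 + \<Delta>"
      then have "int p * int p dvd int p * (2 * z + int p)"
        using True unfolding e power2_eq_square[of "int p"] by (metis dvd_add_right_iff)
      then have "int p dvd 2 * z" using p2 by simp
      then show False using prime_not_dvd_twice[OF p(2) p2 pz] by simp
    qed
    moreover have "int p dvd (z + int p)\<^sup>2 + \<Delta>" unfolding e using z by simp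
    ultimately show ?thesis using that by blast
  qed
  have "coprime (int W') ((int p)\<^sup>2)"
    using coprime_int_prime[OF p(2), of "int W'"] pW by simp
  then obtain c'' where c'': "[c'' = c'] (mod int W')" "[c'' = z'] (mod (int p)\<^sup>2)"
    using binary_chinese_remainder_int by blast
  show ?case
  proof (rule exI[of _ "W' * p\<^sup>2"], rule exI[of _ c''], intro conjI allI impI ballI)
    show "W' * p\<^sup>2 > 0" using W'(1) p2 by simp
    show "W dvd W' * p\<^sup>2" using W'(2) by simp
    have "[c'' = c'] (mod int W)" using c''(1) W'(2) by (meson cong_dvd_modulus of_nat_dvd_iff)
    then show "[c'' = c] (mod int W)" using W'(3) cong_trans by blast
    fix T \<Delta>' assume T: "[T = c''] (mod int (W' * p\<^sup>2))" and "\<Delta>' \<in> insert \<Delta> G"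
    have T1: "[T = c'] (mod int W')"
      using T c''(1) by (metis cong_dvd_modulus cong_trans dvd_triv_left of_nat_mult)
    have "[T = z'] (mod (int p)\<^sup>2)"
      using T c''(2) by (metis cong_dvd_modulus cong_trans dvd_triv_right of_nat_mult of_nat_power)
    then have T2: "[T\<^sup>2 + \<Delta> = z'\<^sup>2 + \<Delta>] (mod (int p)\<^sup>2)" by (intro cong_add cong_pow) auto
    consider "\<Delta>' \<in> G" | "\<Delta>' = \<Delta>" using \<open>\<Delta>' \<in> insert \<Delta> G\<close> by blast
    then show "\<exists>p. prime p \<and> p mod 4 = 3 \<and> \<not> p dvd W \<and>
      int p dvd T\<^sup>2 + \<Delta>' \<and> \<not> (int p)\<^sup>2 dvd T\<^sup>2 + \<Delta>'"
    proof cases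
      case 1
      then show ?thesis using W'(4)[OF T1] by blast
    next
      case 2
      have "int p dvd T\<^sup>2 + \<Delta>"
        using z'(1) T2 by (metis cong_dvd_iff cong_dvd_modulus dvd_triv_left power2_eq_square)
      moreover have "\<not> (int p)\<^sup>2 dvd T\<^sup>2 + \<Delta>" using z'(2) T2 cong_dvd_iff by blast
      moreover have "\<not> p dvd W" using pW W'(2) dvd_trans by blast
      ultimately show ?thesis using p(2,3) 2 by blast
    qed
  qed
qed

section \<open>Two residue classes as norms with a common coordinate\<close>

text \<open>Hensel lifting: \<open>i\<close> is corrected by \<open>p ^ k * t\<close>, where 2 i t =
  -m modulo \<open>p\<close>.\<close>

lemma sqrt_minus_one_prime_power:
  assumes p: "prime p" "p mod 4 = 1"
  shows "\<exists>i. int p ^ k dvd i\<^sup>2 + 1"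
proof (cases "k = 0")
  case False
  have p2: "2 < p" using p prime_ge_2_nat[of p] by (cases "p = 2") auto
  from False have "k > 0" by simp
  then show ?thesis
  proof (induction k rule: nat_induct_non_zero)
    case 1
    then show ?case using QuadRes_minus_one_iff[OF p(1) p2] p(2)
      by (auto simp: QuadRes_def cong_iff_dvd_diff)
  next
    case (Suc k)
    then obtain i m where m: "i\<^sup>2 + 1 = int p ^ k * m" by (elim exE dvdE)
    have pk: "int p dvd int p ^ k" using Suc.hyps by simp
    have "\<not> int p dvd i"
    proof
      assume "int p dvd i"
      then have "int p dvd i\<^sup>2" by (simp add: power2_eq_square)
      moreover have "int p dvd i\<^sup>2 + 1" unfolding m using pk by simp
      ultimately have "int p dvd 1" by (metis dvd_add_right_iff)
      then show False using p2 by auto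
    qed
    then have "\<not> int p dvd 2 * i" by (rule prime_not_dvd_twice[OF p(1) p2])
    then have "coprime (2 * i) (int p)" by (rule coprime_int_prime[OF p(1)])
    then obtain j where "[2 * i * j = 1] (mod int p)" using cong_solve_coprime_int by blast
    then have "[2 * i * j * (- m) = 1 * (- m)] (mod int p)" by (rule cong_scalar_right)
    then have d: "int p dvd m + 2 * i * (j * (- m))"
      by (simp add: cong_iff_dvd_diff algebra_simps)
    define t where "t = j * (- m)"
    have "(i + int p ^ k * t)\<^sup>2 + 1 = (i\<^sup>2 + 1) + int p ^ k * (2 * i * t) + int p ^ k * (int p ^ k * t\<^sup>2)"
      by (simp add: power2_eq_square algebra_simps)
    also have "\<dots> = int p ^ k * ((m + 2 * i * t) + int p ^ k * t\<^sup>2)"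
      unfolding m by (simp add: algebra_simps)
    finally have e: "(i + int p ^ k * t)\<^sup>2 + 1 = int p ^ k * ((m + 2 * i * t) + int p ^ k * t\<^sup>2)" .
    have "int p dvd (m + 2 * i * t) + int p ^ k * t\<^sup>2"
      by (rule dvd_add[OF d[folded t_def] dvd_mult2[OF pk]])
    then have "int p ^ k * int p dvd (i + int p ^ k * t)\<^sup>2 + 1"
      unfolding e by (rule mult_dvd_mono[OF dvd_refl])
    then show ?case by (auto simp: mult.commute)
  qed
qed simp

text \<open>The class \<open>a\<close> is represented by the scaled norm \<open>(T\<^sup>2 + s\<^sup>2) / (x\<^sup>2 + y\<^sup>2)\<close>, and so is \<open>b\<close>, with the
  same \<open>T\<close>, \<open>x\<close>, \<open>y\<close>.\<close>

definition linked_norms :: "nat \<Rightarrow> int \<Rightarrow> int \<Rightarrow> bool" where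
  "linked_norms q a b \<longleftrightarrow> (\<exists>x y T s1 s2. coprime (x\<^sup>2 + y\<^sup>2) (int q) \<and>
    [T\<^sup>2 + s1\<^sup>2 = a * (x\<^sup>2 + y\<^sup>2)] (mod int q) \<and> [T\<^sup>2 + s2\<^sup>2 = b * (x\<^sup>2 + y\<^sup>2)] (mod int q))"

text \<open>With i^2 = -1 a sum of two squares is a product of two linear forms, so any
  factorization of c M yields a representation: \<open>T\<close> is the half sum of the factors, and
  \<open>S c\<close> is their half difference up to a factor i. \<open>M\<close> is chosen to give
  \<open>a\<close> and \<open>b\<close> the same half sum.\<close>

lemma linked_norms_prime_power_1_mod_4:
  assumes p: "prime p" "p mod 4 = 1"
  shows "linked_norms (p ^ k) a b"
proof -
  define n where "n = int p ^ k"
  have p5: "p \<ge> 5" using p prime_ge_2_nat[of p] by presburger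
  obtain i where i: "n dvd i\<^sup>2 + 1" using sqrt_minus_one_prime_power[OF p] n_def by blast
  have small: "\<not> int p dvd m" if "m \<noteq> 0" "\<bar>m\<bar> < 5" for m
    using dvd_imp_le_int[OF that(1), of "int p"] that(2) p5 by auto
  \<comment> \<open>The three candidates are distinct modulo p \<ge> 5, and each of \<open>a\<close>
    and \<open>b\<close> rules out at most one of them.\<close>
  have "\<exists>\<beta>\<in>{1, 2, 3}. \<not> int p dvd a - \<beta> \<and> \<not> int p dvd b - \<beta>"
  proof -
    have diff: "\<not> (int p dvd c - \<beta> \<and> int p dvd c - \<gamma>)" if "\<beta> \<in> {1, 2, 3}" "\<gamma> \<in> {1, 2, 3}" "\<beta> \<noteq> \<gamma>" for c \<beta> \<gamma>
    proof
      assume "int p dvd c - \<beta> \<and> int p dvd c - \<gamma>"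
      then have "int p dvd (c - \<beta>) - (c - \<gamma>)" using dvd_diff by blast
      then show False using small[of "\<gamma> - \<beta>"] that by auto
    qed
    show ?thesis
      using diff[of 1 2 a] diff[of 1 3 a] diff[of 2 3 a] diff[of 1 2 b] diff[of 1 3 b] diff[of 2 3 b] by auto
  qed
  then obtain \<beta> where \<beta>: "\<beta> \<in> {1, 2, 3}" "\<not> int p dvd a - \<beta>" "\<not> int p dvd b - \<beta>" by blast
  have "\<not> int p dvd \<beta>" using \<beta>(1) small[of \<beta>] by auto
  \<comment> \<open>\<open>a * M\<close> is \<beta> (a - \<beta>) times a (b - \<beta>), and
    \<open>b * M\<close> is \<beta> (b - \<beta>) times b (a - \<beta>). Both pairs of factors have
    the sum a b - \<beta>^2, which is 2T modulo \<open>n\<close>.\<close>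
  define M where "M = \<beta> * (a - \<beta>) * (b - \<beta>)"
  have pM: "\<not> int p dvd M"
    using \<beta> \<open>\<not> int p dvd \<beta>\<close> p(1) by (simp add: M_def prime_dvd_mult_iff)
  have "\<not> int p dvd 2" using small[of 2] by simp
  then have "coprime 2 (int p)" by (rule coprime_int_prime[OF p(1)])
  then have "coprime 2 n" by (simp add: n_def)
  then obtain h where "[2 * h = 1] (mod n)" using cong_solve_coprime_int by blast
  then have h: "n dvd 2 * h - 1" by (simp add: cong_iff_dvd_diff)
  define x where "x = h * (M + 1)"
  define y where "y = - i * h * (M - 1)"
  define T where "T = h * (a * b - \<beta>\<^sup>2)"
  define S where "S c = - i * h * (a * b - 2 * c * \<beta> + \<beta>\<^sup>2)" for c
  have key: "[(h * A)\<^sup>2 + (- i * h * s)\<^sup>2 = c * M] (mod n)" if "A\<^sup>2 - s\<^sup>2 = 4 * (c * M)" for A s c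
  proof -
    have e: "(h * A)\<^sup>2 = h\<^sup>2 * (s\<^sup>2 + 4 * (c * M))"
      using that by (simp add: power_mult_distrib)
    have "(h * A)\<^sup>2 + (- i * h * s)\<^sup>2 - c * M
        = (2 * h - 1) * ((2 * h + 1) * (c * M)) + (i\<^sup>2 + 1) * (h * s)\<^sup>2"
      unfolding e by (simp add: power2_eq_square algebra_simps)
    then show ?thesis using h i by (simp add: cong_iff_dvd_diff)
  qed
  have xy: "[x\<^sup>2 + y\<^sup>2 = M] (mod n)"
  proof -
    have "(M + 1)\<^sup>2 - (M - 1)\<^sup>2 = 4 * (1 * M)" by (simp add: power2_eq_square algebra_simps)
    from key[OF this] show ?thesis by (simp add: x_def y_def)
  qed
  have "[T\<^sup>2 + (S a)\<^sup>2 = a * M] (mod n)"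
    unfolding T_def S_def by (rule key) (simp add: M_def power2_eq_square algebra_simps)
  moreover have "[T\<^sup>2 + (S b)\<^sup>2 = b * M] (mod n)"
    unfolding T_def S_def by (rule key) (simp add: M_def power2_eq_square algebra_simps)
  moreover have "[c * M = c * (x\<^sup>2 + y\<^sup>2)] (mod n)" for c
    using xy by (intro cong_scalar_left) (rule cong_sym)
  ultimately have "[T\<^sup>2 + (S a)\<^sup>2 = a * (x\<^sup>2 + y\<^sup>2)] (mod n)" "[T\<^sup>2 + (S b)\<^sup>2 = b * (x\<^sup>2 + y\<^sup>2)] (mod n)"
    using cong_trans by blast+
  moreover have "coprime M n" using coprime_int_prime[OF p(1) pM] by (simp add: n_def)
  then have "coprime (x\<^sup>2 + y\<^sup>2) n" using cong_imp_coprime[OF cong_sym[OF xy]] by blast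
  ultimately show ?thesis unfolding linked_norms_def n_def of_nat_power by blast
qed

text \<open>A Gaussian integer x + iy is sought that gives (u1 + i v1)(x + iy) and (u2 - i v2)(x +
  iy) the same real part \<open>T\<close>. This is one linear equation; it has a solution with
  \<open>x\<close>, \<open>y\<close> coprime, and then \<open>p\<close> cannot divide x^2 +
  y^2.\<close>

lemma linked_norms_prime_power_3_mod_4:
  assumes p: "prime p" "p mod 4 = 3" and ad: "admissible (p ^ k) a" "admissible (p ^ k) b"
  shows "linked_norms (p ^ k) a b"
proof -
  obtain u1 v1 where 1: "[u1\<^sup>2 + v1\<^sup>2 = a] (mod int (p ^ k))" using ad by (auto simp: admissible_def)
  obtain u2 v2 where 2: "[u2\<^sup>2 + v2\<^sup>2 = b] (mod int (p ^ k))" using ad by (auto simp: admissible_def)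
  have "\<exists>x y. coprime x y \<and> x * (u1 - u2) = y * (v1 + v2)"
  proof (cases "u1 - u2 = 0 \<and> v1 + v2 = 0")
    case True
    then show ?thesis by (intro exI[of _ 1] exI[of _ 0]) auto
  next
    case False
    define g where "g = gcd (v1 + v2) (u1 - u2)"
    have "g \<noteq> 0" using False by (auto simp: g_def)
    then have "\<exists>x y. v1 + v2 = x * g \<and> u1 - u2 = y * g \<and> coprime x y"
      unfolding g_def by (rule gcd_coprime_exists)
    then obtain x y where xy: "v1 + v2 = x * g" "u1 - u2 = y * g" "coprime x y" by blast
    have "x * (u1 - u2) = y * (v1 + v2)" unfolding xy(1,2) by simp
    then show ?thesis using xy(3) by blast
  qed
  then obtain x y where xy: "coprime x y" "x * (u1 - u2) = y * (v1 + v2)" by blast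
  define T where "T = u1 * x - v1 * y"
  have T2: "T = u2 * x + v2 * y" using xy(2) by (simp add: T_def algebra_simps)
  have e1: "T\<^sup>2 + (u1 * y + v1 * x)\<^sup>2 = (u1\<^sup>2 + v1\<^sup>2) * (x\<^sup>2 + y\<^sup>2)"
    by (simp add: T_def power2_eq_square algebra_simps)
  have e2: "T\<^sup>2 + (v2 * x - u2 * y)\<^sup>2 = (u2\<^sup>2 + v2\<^sup>2) * (x\<^sup>2 + y\<^sup>2)"
    unfolding T2 by (simp add: power2_eq_square algebra_simps)
  have "[T\<^sup>2 + (u1 * y + v1 * x)\<^sup>2 = a * (x\<^sup>2 + y\<^sup>2)] (mod int (p ^ k))"
    unfolding e1 by (rule cong_scalar_right[OF 1])
  moreover have "[T\<^sup>2 + (v2 * x - u2 * y)\<^sup>2 = b * (x\<^sup>2 + y\<^sup>2)] (mod int (p ^ k))"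
    unfolding e2 by (rule cong_scalar_right[OF 2])
  moreover have "\<not> int p dvd x\<^sup>2 + y\<^sup>2"
  proof
    assume "int p dvd x\<^sup>2 + y\<^sup>2"
    from prime_3_mod_4_dvd_sum_squares[OF p this] have "int p dvd x" "int p dvd y" by simp_all
    then have "is_unit (int p)" by (rule coprime_common_divisor[OF xy(1)])
    then show False using p(1) by simp
  qed
  then have "coprime (x\<^sup>2 + y\<^sup>2) (int p)" by (rule coprime_int_prime[OF p(1)])
  then have "coprime (x\<^sup>2 + y\<^sup>2) (int (p ^ k))" by simp
  ultimately show ?thesis unfolding linked_norms_def by blast
qed

lemma linked_norms_mult:
  assumes "linked_norms m a b" "linked_norms n a b" and mn: "coprime m n"
  shows "linked_norms (m * n) a b"
proof -
  obtain x y T s t where 1: "coprime (x\<^sup>2 + y\<^sup>2) (int m)"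
    "[T\<^sup>2 + s\<^sup>2 = a * (x\<^sup>2 + y\<^sup>2)] (mod int m)" "[T\<^sup>2 + t\<^sup>2 = b * (x\<^sup>2 + y\<^sup>2)] (mod int m)"
    using assms(1) unfolding linked_norms_def by blast
  obtain x' y' T' s' t' where 2: "coprime (x'\<^sup>2 + y'\<^sup>2) (int n)"
    "[T'\<^sup>2 + s'\<^sup>2 = a * (x'\<^sup>2 + y'\<^sup>2)] (mod int n)" "[T'\<^sup>2 + t'\<^sup>2 = b * (x'\<^sup>2 + y'\<^sup>2)] (mod int n)"
    using assms(2) unfolding linked_norms_def by blast
  have cop: "coprime (int m) (int n)" using mn by simp
  obtain X where X: "[X = x] (mod int m)" "[X = x'] (mod int n)" using binary_chinese_remainder_int[OF cop] by blast
  obtain Y where Y: "[Y = y] (mod int m)" "[Y = y'] (mod int n)" using binary_chinese_remainder_int[OF cop] by blast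
  obtain U where U: "[U = T] (mod int m)" "[U = T'] (mod int n)" using binary_chinese_remainder_int[OF cop] by blast
  obtain V where V: "[V = s] (mod int m)" "[V = s'] (mod int n)" using binary_chinese_remainder_int[OF cop] by blast
  obtain W where W: "[W = t] (mod int m)" "[W = t'] (mod int n)" using binary_chinese_remainder_int[OF cop] by blast
  have N: "[X\<^sup>2 + Y\<^sup>2 = x\<^sup>2 + y\<^sup>2] (mod int m)" "[X\<^sup>2 + Y\<^sup>2 = x'\<^sup>2 + y'\<^sup>2] (mod int n)"
    using X Y by (auto intro!: cong_add cong_pow)
  have *: "[R\<^sup>2 + Q\<^sup>2 = c * N] (mod k)"
    if "[r\<^sup>2 + q\<^sup>2 = c * N'] (mod k)" "[R = r] (mod k)" "[Q = q] (mod k)" "[N = N'] (mod k)" for R Q r q c N N' k :: int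
  proof -
    have "[R\<^sup>2 + Q\<^sup>2 = r\<^sup>2 + q\<^sup>2] (mod k)" using that by (auto intro!: cong_add cong_pow)
    also have "[r\<^sup>2 + q\<^sup>2 = c * N'] (mod k)" by (rule that)
    also have "[c * N' = c * N] (mod k)" using that(4) by (intro cong_scalar_left) (rule cong_sym)
    finally show ?thesis .
  qed
  have "coprime (X\<^sup>2 + Y\<^sup>2) (int m * int n)"
    using cong_imp_coprime[OF cong_sym[OF N(1)] 1(1)] cong_imp_coprime[OF cong_sym[OF N(2)] 2(1)] by simp
  moreover have "[U\<^sup>2 + V\<^sup>2 = a * (X\<^sup>2 + Y\<^sup>2)] (mod int m * int n)"
    using *[OF 1(2) U(1) V(1) N(1)] *[OF 2(2) U(2) V(2) N(2)] cop by (rule coprime_cong_mult)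
  moreover have "[U\<^sup>2 + W\<^sup>2 = b * (X\<^sup>2 + Y\<^sup>2)] (mod int m * int n)"
    using *[OF 1(3) U(1) W(1) N(1)] *[OF 2(3) U(2) W(2) N(2)] cop by (rule coprime_cong_mult)
  ultimately show ?thesis unfolding linked_norms_def of_nat_mult by blast
qed

lemma admissible_dvd:
  assumes "admissible n a" "m dvd n"
  shows "admissible m a"
  using assms unfolding admissible_def by (meson cong_dvd_modulus of_nat_dvd_iff)

lemma admissible_linked_norms:
  assumes "q > 0" "odd q" "admissible q a" "admissible q b"
  shows "linked_norms q a b"
  using assms
proof (induction q rule: less_induct)
  case (less q)
  show ?case
  proof (cases "q = 1")
    case True
    then show ?thesis by (simp add: linked_norms_def)
  next
    case False
    then obtain p where p: "prime p" "p dvd q" using prime_factor_nat by blast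
    define k where "k = multiplicity p q"
    obtain m where m: "q = p ^ k * m" "\<not> p dvd m"
      using multiplicity_decompose'[of q p] less.prems(1) p(1) unfolding k_def by (metis not_prime_unit not_gr_zero)
    have k: "k > 0" using p m by (metis gr0I mult_1 power_0)
    have cop: "coprime (p ^ k) m" using m(2) p(1) by (simp add: prime_imp_coprime)
    have "m > 0" using m less.prems(1) by (metis mult_0_right not_gr_zero)
    moreover have "1 < p ^ k" using k prime_gt_1_nat[OF p(1)] by (intro one_less_power)
    ultimately have "m < q" using m(1) by (metis mult_less_mono1 mult_1)
    moreover have "odd m" "odd (p ^ k)" using less.prems(2) m(1) by auto
    moreover have ad: "admissible m a" "admissible m b" "admissible (p ^ k) a" "admissible (p ^ k) b"
      using less.prems m(1) by (auto intro: admissible_dvd)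
    ultimately have "linked_norms m a b" using less.IH \<open>m > 0\<close> by blast
    moreover have "odd p" using \<open>odd (p ^ k)\<close> k by simp
    then have "p mod 4 = 1 \<or> p mod 4 = 3" by presburger
    then have "linked_norms (p ^ k) a b"
      using linked_norms_prime_power_1_mod_4[OF p(1)] linked_norms_prime_power_3_mod_4[OF p(1) _ ad(3,4)] by blast
    ultimately show ?thesis using linked_norms_mult[OF _ _ cop] m(1) by blast
  qed
qed

section \<open>Square roots forming subset sums\<close>

lemma chinese_remainder_3_int:
  fixes m1 m2 m3 u1 u2 u3 :: int
  assumes pos: "m1 > 0" "m2 > 0" "m3 > 0"
    and cop: "coprime m1 m2" "coprime m1 m3" "coprime m2 m3"
  shows "\<exists>z>0. [z = u1] (mod m1) \<and> [z = u2] (mod m2) \<and> [z = u3] (mod m3)"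
proof -
  obtain z12 where z12: "[z12 = u1] (mod m1)" "[z12 = u2] (mod m2)"
    using binary_chinese_remainder_int[OF cop(1)] by blast
  have "coprime (m1 * m2) m3" using cop by simp
  then obtain z where z: "[z = z12] (mod m1 * m2)" "[z = u3] (mod m3)"
    using binary_chinese_remainder_int by blast
  define m where "m = m1 * m2 * m3"
  define w where "w = z mod m + m"
  have m: "m > 0" using pos by (simp add: m_def)
  then have "w > 0" using pos_mod_sign[OF m, of z] m unfolding w_def by linarith
  have wm: "[w = z] (mod m)" by (simp add: w_def unique_euclidean_semiring_class.cong_def)
  have "[z = u1] (mod m1)" "[z = u2] (mod m2)"
    using cong_trans[OF cong_dvd_modulus[OF z(1)] z12(1)] cong_trans[OF cong_dvd_modulus[OF z(1)] z12(2)]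
    by simp_all
  moreover have "m1 dvd m" "m2 dvd m" "m3 dvd m" by (simp_all add: m_def)
  ultimately have "[w = u1] (mod m1)" "[w = u2] (mod m2)" "[w = u3] (mod m3)"
    using z(2) cong_trans[OF cong_dvd_modulus[OF wm]] by blast+
  then show ?thesis using \<open>w > 0\<close> by blast
qed

lemma coprime_prod_primes_int:
  fixes S :: "nat set"
  assumes "finite S" "\<And>p. p \<in> S \<Longrightarrow> prime p \<and> \<not> int p dvd a"
  shows "coprime a (int (\<Prod>S))"
  using assms by (auto intro!: prod_coprime_right coprime_int_prime)

lemma sqrt_minus_one_prod_primes:
  assumes "finite S" "\<forall>p\<in>S. prime p \<and> p mod 4 = 1"
  shows "\<exists>i. int (\<Prod>S) dvd i\<^sup>2 + 1"
  using assms
proof (induction S rule: finite_induct)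
  case (insert p S)
  obtain i where i: "int (\<Prod>S) dvd i\<^sup>2 + 1" using insert by auto
  obtain i' where i': "int p dvd i'\<^sup>2 + 1" using sqrt_minus_one_prime_power[of p 1] insert.prems by auto
  have "p' \<in> S \<Longrightarrow> \<not> int p' dvd int p" for p'
    using insert.hyps(2) insert.prems by (auto dest: primes_dvd_imp_eq)
  then have cop: "coprime (int p) (int (\<Prod>S))"
    using insert.hyps(1) insert.prems by (intro coprime_prod_primes_int) auto
  obtain z where z: "[z = i'] (mod int p)" "[z = i] (mod int (\<Prod>S))"
    using binary_chinese_remainder_int[OF cop] by blast
  have c: "[z\<^sup>2 + 1 = i'\<^sup>2 + 1] (mod int p)" "[z\<^sup>2 + 1 = i\<^sup>2 + 1] (mod int (\<Prod>S))"
    using z by (auto intro!: cong_add cong_pow)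
  have "int p * int (\<Prod>S) dvd z\<^sup>2 + 1"
    using i i' cong_dvd_iff[OF c(1)] cong_dvd_iff[OF c(2)] cop by (intro divides_mult) auto
  then show ?case using insert.hyps by auto
qed auto

text \<open>Modulo a prime \<open>p\<close> of \<open>S\<close>, a root \<open>s\<close> is s0 or
  -s0, and -s0 is \<open>s0 + E p\<close>. With \<open>I\<close> the primes where \<open>s\<close>
  differs from \<open>s0\<close>, the difference s - s0 agrees with \<open>sum E I\<close> modulo
  every prime of \<open>S\<close>, and by size the two are equal.\<close>

lemma square_root_eq_subset_sum:
  fixes S :: "nat set" and E :: "nat \<Rightarrow> int"
  assumes S: "finite S" "\<And>p. p \<in> S \<Longrightarrow> prime p"
    and E: "\<And>p p'. p \<in> S \<Longrightarrow> p' \<in> S \<Longrightarrow> p \<noteq> p' \<Longrightarrow> int p dvd E p'" "\<And>p. p \<in> S \<Longrightarrow> E p \<ge> 0"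
    and s0: "\<And>p. p \<in> S \<Longrightarrow> int p dvd 2 * s0 + E p"
    and lt: "sum E S < int (\<Prod>S)"
    and s: "s0 \<le> s" "s < s0 + int (\<Prod>S)" and d: "int (\<Prod>S) dvd s\<^sup>2 - s0\<^sup>2"
  shows "\<exists>I\<subseteq>S. s = s0 + sum E I"
proof -
  define I where "I = {p \<in> S. \<not> int p dvd s - s0}"
  have I: "I \<subseteq> S" "finite I" using S by (auto simp: I_def)
  have "int p dvd (s - s0) - sum E I" if p: "p \<in> S" for p
  proof (cases "p \<in> I")
    case True
    have "int p dvd int (\<Prod>S)" using S p by (auto intro: dvd_prodI)
    then have "int p dvd (s - s0) * (s + s0)"
      using d by (metis dvd_trans mult.commute power2_eq_square square_diff_square_factored)
    then have "int p dvd s + s0" using True S(2)[OF p] by (auto simp: I_def prime_dvd_mult_iff)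
    moreover have "int p dvd sum E (I - {p})"
      using E(1) p I by (intro dvd_sum) auto
    ultimately have "int p dvd (s + s0) - (2 * s0 + E p) - sum E (I - {p})"
      using s0[OF p] by (intro dvd_diff)
    also have "(s + s0) - (2 * s0 + E p) - sum E (I - {p}) = (s - s0) - sum E I"
      using sum.remove[OF I(2) True, of E] by simp
    finally show ?thesis .
  next
    case False
    then have "int p dvd s - s0" using p by (simp add: I_def)
    moreover have "int p dvd sum E I"
      using E(1) p I False by (intro dvd_sum) auto
    ultimately show ?thesis by (rule dvd_diff)
  qed
  then have dv: "int (\<Prod>S) dvd (s - s0) - sum E I"
    using S by (intro prod_primes_dvd_int) auto
  have "0 \<le> sum E I" using E(2) I by (intro sum_nonneg) auto
  moreover have "sum E I \<le> sum E S" using E(2) I S by (intro sum_mono2) auto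
  ultimately have "\<bar>(s - s0) - sum E I\<bar> < int (\<Prod>S)" using lt s by linarith
  then have "(s - s0) - sum E I = 0" using dv dvd_imp_le_int[of "(s - s0) - sum E I"] by fastforce
  then show ?thesis using I by (intro exI[of _ I]) auto
qed

text \<open>Modulo \<open>p\<close> the sum over \<open>I\<close> reduces to \<open>E p\<close> or
  to 0, so the shifted number is -s0 or s0.\<close>

lemma square_roots_of_subset_sum:
  fixes S :: "nat set" and E :: "nat \<Rightarrow> int"
  assumes S: "finite S" "\<And>p. p \<in> S \<Longrightarrow> prime p"
    and E: "\<And>p p'. p \<in> S \<Longrightarrow> p' \<in> S \<Longrightarrow> p \<noteq> p' \<Longrightarrow> int p dvd E p'"
    and s0: "\<And>p. p \<in> S \<Longrightarrow> int p dvd 2 * s0 + E p" and I: "I \<subseteq> S"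
  shows "int (\<Prod>S) dvd (s0 + sum E I)\<^sup>2 - s0\<^sup>2"
proof (rule prod_primes_dvd_int[OF S])
  fix p assume p: "p \<in> S"
  have fin: "finite I" using I S finite_subset by blast
  have e: "(s0 + sum E I)\<^sup>2 - s0\<^sup>2 = sum E I * (2 * s0 + sum E I)"
    by (simp add: power2_eq_square algebra_simps)
  show "int p dvd (s0 + sum E I)\<^sup>2 - s0\<^sup>2"
  proof (cases "p \<in> I")
    case True
    have "int p dvd sum E (I - {p})" using E p I by (intro dvd_sum) auto
    then have "int p dvd (2 * s0 + E p) + sum E (I - {p})" using s0[OF p] by (rule dvd_add[rotated])
    also have "\<dots> = 2 * s0 + sum E I" using sum.remove[OF fin True, of E] by simp
    finally show ?thesis unfolding e by simp
  next
    case False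
    then have "int p dvd sum E I" using E p I by (intro dvd_sum) auto
    then show ?thesis unfolding e by simp
  qed
qed

text \<open>Restricting to primes in a single class modulo \<open>q\<close> makes the product of \<open>\<phi>(q) t\<close> of them
  congruent to 1, without appealing to Dirichlet's theorem.\<close>

lemma infinite_primes_product_cong_1:
  fixes q :: nat
  assumes q: "q > 0"
  shows "\<exists>F. infinite F \<and> (\<forall>p\<in>F. prime p \<and> p mod 4 = 1) \<and>
    (\<forall>S. finite S \<longrightarrow> S \<subseteq> F \<longrightarrow> totient q dvd card S \<longrightarrow> [\<Prod>S = 1] (mod q))"
proof -
  define A where "A = {p::nat. prime p \<and> p mod 4 = 1} - {..q}"
  have infA: "infinite A" unfolding A_def
    by (rule Diff_infinite_finite[OF finite_atMost infinite_primes_1_mod_4])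
  have finq: "finite ((\<lambda>p. p mod q) ` A)"
    by (rule finite_subset[of _ "{..<q}"]) (use q in auto)
  obtain p0 where p0: "p0 \<in> A" "infinite {p \<in> A. p mod q = p0 mod q}"
    using pigeonhole_infinite[OF infA finq] by blast
  define F where "F = {p \<in> A. p mod q = p0 mod q}"
  have cop: "coprime p0 q"
  proof -
    have "prime p0" "\<not> p0 dvd q" using p0(1) q by (auto simp: A_def dest: dvd_imp_le)
    then show ?thesis by (rule prime_imp_coprime)
  qed
  have "[\<Prod>S = 1] (mod q)" if S: "finite S" "S \<subseteq> F" "totient q dvd card S" for S
  proof -
    obtain t where t: "card S = totient q * t" using S(3) by (elim dvdE)
    have "[\<Prod>S = (\<Prod>p\<in>S. p0)] (mod q)"
      using S(2) by (intro cong_prod) (auto simp: F_def unique_euclidean_semiring_class.cong_def)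
    also have "(\<Prod>p\<in>S. p0) = (p0 ^ totient q) ^ t" by (simp add: t power_mult)
    also have "[(p0 ^ totient q) ^ t = 1 ^ t] (mod q)"
      by (intro cong_pow euler_theorem cop)
    finally show ?thesis by simp
  qed
  then show ?thesis using p0(2) by (intro exI[of _ F]) (auto simp: F_def A_def)
qed

text \<open>The offsets \<open>E p\<close> equal \<open>c\<^sub>p M (\<Prod>S) / p\<close> with \<open>c\<^sub>p\<close> small compared to \<open>p\<close>, so that all subset
  sums stay below \<open>\<Prod>S\<close>.\<close>

lemma offsets_exist:
  fixes q J M :: nat and w :: int
  assumes q: "q > 0" and M: "M > 0" "coprime M q"
  shows "\<exists>S r (E :: nat \<Rightarrow> int). finite S \<and> (\<forall>p\<in>S. prime p \<and> p mod 4 = 1 \<and> \<not> p dvd M) \<and>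
    r \<in> S \<and> J \<le> card (S - {r}) \<and> [\<Prod>S = 1] (mod q) \<and>
    (\<forall>p\<in>S. E p > 0 \<and> int M dvd E p) \<and> (\<forall>p\<in>S. \<forall>p'\<in>S. p \<noteq> p' \<longrightarrow> int p dvd E p') \<and>
    (\<forall>p\<in>S - {r}. int q dvd E p) \<and> [E r = w] (mod int q) \<and> inj_on E (S - {r}) \<and>
    sum E (S - {r}) < E r \<and> sum E S < int (\<Prod>S)"
proof -
  obtain F where F: "infinite F" "\<And>p. p \<in> F \<Longrightarrow> prime p \<and> p mod 4 = 1"
    "\<And>S. finite S \<Longrightarrow> S \<subseteq> F \<Longrightarrow> totient q dvd card S \<Longrightarrow> [\<Prod>S = 1] (mod q)"
    using infinite_primes_product_cong_1[OF q] by blast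
  \<comment> \<open>The number of primes: a multiple of \<open>totient q\<close>, to make their
    product 1 modulo \<open>q\<close>, and large enough to leave \<open>J\<close> primes besides
    \<open>r\<close>.\<close>
  define n where "n = totient q * (J + 1)"
  have n: "J + 1 \<le> n"
  proof -
    have "1 \<le> totient q" using q by (simp add: Suc_le_eq)
    then have "1 * (J + 1) \<le> totient q * (J + 1)" by (rule mult_le_mono1)
    then show ?thesis by (simp add: n_def)
  qed
  obtain r where r: "r \<in> F" "r > 2 * M * q"
    using F(1) by (meson infinite_nat_iff_unbounded)
  \<comment> \<open>With \<open>Q = \<Prod>S\<close>, each prime p > L has the offset q M Q / p
    \<le> Q / (2 n r). Together these offsets are at most half of E r = v M Q / r, and r > 2 M q
    keeps \<open>E r\<close> itself at most Q / 2.\<close>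
  define L where "L = 2 * M * q * n * r"
  have "infinite (F - {..L})" using F(1) by simp
  then obtain P where P: "finite P" "card P = n - 1" "P \<subseteq> F - {..L}"
    using infinite_arbitrarily_large by blast
  have Pbig: "p > L" "p \<in> F" if "p \<in> P" for p using P(3) that by auto
  have "1 \<le> 2 * M * q * n" using q M(1) n by (simp add: Suc_le_eq)
  then have rL: "r \<le> L" unfolding L_def by simp
  have rP: "r \<notin> P" using Pbig(1)[of r] rL by auto
  define S where "S = insert r P"
  have SP: "S - {r} = P" using rP by (auto simp: S_def)
  have S: "finite S" "S \<subseteq> F" using P(1) r(1) Pbig by (auto simp: S_def)
  have cS: "card S = n" using P(1,2) rP n by (simp add: S_def)
  have pS: "prime p" "p mod 4 = 1" if "p \<in> S" for p using F(2) S(2) that by auto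
  have bigS: "p > 2 * M * q" if "p \<in> S" for p
    using that r(2) Pbig(1)[of p] rL by (auto simp: S_def)
  have ndM: "\<not> p dvd M" if "p \<in> S" for p
  proof
    assume "p dvd M"
    then have "p \<le> M" using M(1) by (rule dvd_imp_le)
    also have "M \<le> 2 * M * q" using q by simp
    finally show False using bigS[OF that] by simp
  qed
  define Q where "Q = int (\<Prod>S)"
  have Pi1: "[\<Prod>S = 1] (mod q)" using F(3)[OF S] cS by (simp add: n_def)
  have "\<Prod>S > 0" using pS by (auto intro!: prod_pos simp: prime_gt_0_nat)
  then have Pi0: "Q > 0" unfolding Q_def by (simp only: of_nat_0_less_iff)
  have PiP: "\<Prod>S = r * \<Prod>P" using P(1) rP by (simp add: S_def)
  have "coprime (\<Prod>S) q" using Pi1 by (metis cong_imp_coprime cong_sym coprime_1_left)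
  then have "coprime (\<Prod>P) q" by (simp add: PiP)
  then have "coprime (int M * int (\<Prod>P)) (int q)" using M(2)
    by (metis coprime_int_iff coprime_mult_left_iff of_nat_mult)
  then obtain t where t: "[int M * int (\<Prod>P) * t = 1] (mod int q)" using cong_solve_coprime_int by blast
  \<comment> \<open>The representative of \<open>t * w\<close> between 1 and \<open>q\<close>,
    rather than between 0 and q - 1, so that \<open>E r\<close> is positive.\<close>
  define v where "v = (t * w - 1) mod int q + 1"
  have v: "1 \<le> v" "v \<le> int q"
  proof -
    have "int q > 0" using q by simp
    from pos_mod_sign[OF this, of "t * w - 1"] pos_mod_bound[OF this, of "t * w - 1"]
    show "1 \<le> v" "v \<le> int q" unfolding v_def by linarith+
  qed
  have "[v = (t * w - 1) + 1] (mod int q)" unfolding v_def by (intro cong_add) simp_all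
  then have vt: "[v = t * w] (mod int q)" by simp
  \<comment> \<open>The factor \<open>q\<close> makes the other offsets vanish modulo
    \<open>q\<close>, while \<open>v\<close> gives \<open>E r\<close> the residue \<open>w\<close>,
    because \<open>t\<close> inverts \<open>int M * int (\<Prod>P)\<close>.\<close>
  define c where "c p = (if p = r then v else int q)" for p
  define E where "E p = c p * int M * int (\<Prod>(S - {p}))" for p
  have c: "1 \<le> c p" "c p \<le> int q" for p using v q by (auto simp: c_def)
  have E0: "E p > 0" if "p \<in> S" for p
  proof -
    have "\<Prod>(S - {p}) > 0" by (intro prod_pos) (metis DiffD1 pS(1) prime_gt_0_nat)
    then have "0 < int (\<Prod>(S - {p}))" by (simp only: of_nat_0_less_iff)
    then show ?thesis using c(1)[of p] M(1) unfolding E_def by (intro mult_pos_pos) auto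
  qed
  have Ep: "E p * int p = c p * int M * Q" if "p \<in> S" for p
  proof -
    have "\<Prod>S = p * \<Prod>(S - {p})" using prod.remove[OF S(1) that, of "\<lambda>x. x"] by simp
    then have "Q = int p * int (\<Prod>(S - {p}))" unfolding Q_def by (simp only: of_nat_mult)
    then show ?thesis by (simp only: E_def mult_ac)
  qed
  have "int p dvd E p'" if "p \<in> S" "p' \<in> S" "p \<noteq> p'" for p p'
  proof -
    have "p dvd \<Prod>(S - {p'})" using S(1) that by (intro dvd_prodI) auto
    then have "int p dvd int (\<Prod>(S - {p'}))" by (simp only: of_nat_dvd_iff)
    then show ?thesis unfolding E_def by (rule dvd_mult)
  qed
  moreover have "[E r = w] (mod int q)"
  proof -
    have "E r = v * (int M * int (\<Prod>P))" by (simp only: E_def c_def SP simp_thms if_True mult.assoc)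
    moreover have "[v * (int M * int (\<Prod>P)) = t * w * (int M * int (\<Prod>P))] (mod int q)"
      using vt by (rule cong_scalar_right)
    moreover have "[int M * int (\<Prod>P) * t * w = 1 * w] (mod int q)"
      using t by (rule cong_scalar_right)
    then have "[t * w * (int M * int (\<Prod>P)) = w] (mod int q)" by (simp only: mult_ac mult_1_left)
    ultimately show ?thesis by (metis cong_trans)
  qed
  moreover have "inj_on E (S - {r})"
  proof (rule inj_onI)
    fix p p' assume p: "p \<in> S - {r}" "p' \<in> S - {r}" "E p = E p'"
    then have "E p * int p = E p * int p'" using Ep[of p] Ep[of p'] by (auto simp: c_def)
    then show "p = p'" using E0[of p] p by simp
  qed
  moreover have "sum E (S - {r}) < E r \<and> sum E S < int (\<Prod>S)"
  proof -
    have rS: "r \<in> S" by (simp add: S_def)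
    have "E p * (2 * int n * int r) \<le> Q" if p: "p \<in> P" for p
    proof -
      have pin: "p \<in> S" "p \<noteq> r" using p rP by (auto simp: S_def)
      have "E p * int L \<le> E p * int p"
        using E0[OF pin(1)] Pbig(1)[OF p] by (intro mult_left_mono) auto
      then have "(int q * int M) * (E p * (2 * int n * int r)) \<le> (int q * int M) * Q"
        using Ep[OF pin(1)] pin(2) by (simp add: L_def c_def mult_ac)
      moreover have "int q * int M > 0" using q M(1) by simp
      ultimately show ?thesis by (simp only: mult_le_cancel_left_pos)
    qed
    then have "(\<Sum>p\<in>P. E p * (2 * int n * int r)) \<le> (\<Sum>p\<in>P. Q)" by (rule sum_mono)
    then have "sum E P * (2 * int n * int r) \<le> int (n - 1) * Q"
      by (simp add: P(2) sum_distrib_right)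
    also have "\<dots> \<le> int n * Q" using Pi0 by (intro mult_right_mono) auto
    finally have "int n * (sum E P * (2 * int r)) \<le> int n * Q" by (simp add: mult_ac)
    then have "sum E P * (2 * int r) \<le> Q" using n by simp
    also have "Q \<le> v * int M * Q"
    proof -
      have "1 * 1 \<le> v * int M" using v M(1) by (intro mult_mono) auto
      then show ?thesis using Pi0 mult_right_mono[of 1 "v * int M" Q] by simp
    qed
    also have "\<dots> = E r * int r" using Ep[OF rS] by (simp add: c_def)
    finally have "int r * (2 * sum E P) \<le> int r * E r" by (simp add: mult_ac)
    then have le: "2 * sum E P \<le> E r" using r(2) by simp
    have "sum E P \<ge> 0" using E0 by (intro sum_nonneg) (auto simp: S_def less_imp_le)
    then have lt: "sum E P < E r" using le E0[OF rS] by linarith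
    have "int (2 * M * q) \<le> int r" using r(2) by (simp only: of_nat_le_iff less_imp_le)
    then have "E r * (2 * int M * int q) \<le> E r * int r"
      using E0[OF rS] by (intro mult_left_mono) simp_all
    also have "\<dots> = v * int M * Q" using Ep[OF rS] by (simp add: c_def)
    also have "\<dots> \<le> int q * int M * Q" using v Pi0 by (intro mult_right_mono) auto
    finally have "(int q * int M) * (2 * E r) \<le> (int q * int M) * Q" by (simp add: mult_ac)
    moreover have "int q * int M > 0" using q M(1) by simp
    ultimately have "2 * E r \<le> Q" by (simp only: mult_le_cancel_left_pos)
    moreover have "sum E S = E r + sum E P" using P(1) rP by (simp add: S_def)
    ultimately show ?thesis using lt by (simp add: SP Q_def)
  qed
  moreover have "int q dvd E p" if "p \<in> S - {r}" for p using that by (auto simp: E_def c_def)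
  moreover have "J \<le> card (S - {r})" using SP P(2) n by simp
  moreover have "int M dvd E p" for p by (simp add: E_def)
  moreover have "r \<in> S" by (simp add: S_def)
  ultimately show ?thesis using S(1) pS ndM Pi1 E0
    by (intro exI[of _ S] exI[of _ r] exI[of _ E]) auto
qed

section \<open>Windows with two residue classes\<close>

text \<open>Gaussian division: the congruences make both \<open>T * y + s * x\<close> and
  \<open>s * y - T * x\<close> divisible by \<open>M\<close>, so (T^2 + s^2) / M is again a sum of
  two squares. The primes of \<open>S\<close> are then divided out.\<close>

lemma sum_squares_div_composite:
  fixes T s x y M :: int
  assumes M: "M = x\<^sup>2 + y\<^sup>2" "M > 0" and T: "[T = y] (mod M)" and s: "[s = x] (mod M)"
    and S: "finite S" "\<forall>p\<in>S. prime p \<and> p mod 4 = 1" and d: "M * int (\<Prod>S) dvd T\<^sup>2 + s\<^sup>2"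
  shows "\<exists>e\<in>sums_two_squares. T\<^sup>2 + s\<^sup>2 = M * int (\<Prod>S) * int e"
proof -
  have cX: "[T * y + s * x = y * y + x * x] (mod M)"
    by (rule cong_add[OF cong_mult[OF T cong_refl] cong_mult[OF s cong_refl]])
  have "M dvd y * y + x * x" unfolding M(1) by (simp add: power2_eq_square add.commute)
  then have "M dvd T * y + s * x" using cong_dvd_iff[OF cX] by blast
  then obtain X where X: "T * y + s * x = M * X" by (elim dvdE)
  have "[s * y - T * x = x * y - y * x] (mod M)"
    by (rule cong_diff[OF cong_mult[OF s cong_refl] cong_mult[OF T cong_refl]])
  then have "M dvd s * y - T * x" by (simp add: cong_iff_dvd_diff)
  then obtain Y where Y: "s * y - T * x = M * Y" by (elim dvdE)
  have "M * (M * (X\<^sup>2 + Y\<^sup>2)) = (T * y + s * x)\<^sup>2 + (s * y - T * x)\<^sup>2"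
    unfolding X Y by (simp add: power2_eq_square algebra_simps)
  also have "\<dots> = M * (T\<^sup>2 + s\<^sup>2)" unfolding M(1) by (simp add: power2_eq_square algebra_simps)
  finally have XY: "T\<^sup>2 + s\<^sup>2 = M * (X\<^sup>2 + Y\<^sup>2)" using M(2) by simp
  then have "int (\<Prod>S) dvd X\<^sup>2 + Y\<^sup>2" using d M(2) by simp
  then obtain U V where UV: "X\<^sup>2 + Y\<^sup>2 = int (\<Prod>S) * (U\<^sup>2 + V\<^sup>2)"
    using sum_squares_div_prod_primes[OF S] by blast
  show ?thesis
  proof (intro bexI)
    show "T\<^sup>2 + s\<^sup>2 = M * int (\<Prod>S) * int ((nat \<bar>U\<bar>)\<^sup>2 + (nat \<bar>V\<bar>)\<^sup>2)"
      unfolding XY UV by simp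
    show "(nat \<bar>U\<bar>)\<^sup>2 + (nat \<bar>V\<bar>)\<^sup>2 \<in> sums_two_squares"
      by (auto simp: sums_two_squares_def)
  qed
qed

text \<open>\<open>lo\<close>, \<open>mid\<close> and \<open>hi\<close> are the values
  \<open>e I\<close> for \<open>I\<close> empty, \<open>S - {r}\<close> and \<open>S\<close>. Every
  sum of two squares between \<open>lo\<close> and \<open>hi\<close> is some \<open>e I\<close>.
  These values are ordered by the subset sums, so those with \<open>r\<close> in \<open>I\<close>
  come last, and membership of \<open>r\<close> decides the class.\<close>

lemma two_class_window:
  fixes q J N :: nat and a b :: int
  assumes q: "q > 0" "odd q" and ad: "admissible q a" "admissible q b"
  shows "\<exists>lo mid hi. N < lo \<and>
    (\<forall>e\<in>sums_two_squares. lo \<le> e \<longrightarrow> e \<le> mid \<longrightarrow> [int e = a] (mod int q)) \<and>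
    (\<forall>e\<in>sums_two_squares. mid < e \<longrightarrow> e \<le> hi \<longrightarrow> [int e = b] (mod int q)) \<and>
    J \<le> card {e \<in> sums_two_squares. lo \<le> e \<and> e \<le> mid} \<and>
    J \<le> card {e \<in> sums_two_squares. mid < e \<and> e \<le> hi}"
proof -
  obtain x0 y T0 s1 s2 where ln: "coprime (x0\<^sup>2 + y\<^sup>2) (int q)"
    "[T0\<^sup>2 + s1\<^sup>2 = a * (x0\<^sup>2 + y\<^sup>2)] (mod int q)" "[T0\<^sup>2 + s2\<^sup>2 = b * (x0\<^sup>2 + y\<^sup>2)] (mod int q)"
    using admissible_linked_norms[OF q ad] unfolding linked_norms_def by blast
  \<comment> \<open>\<open>x0\<close> and \<open>y\<close> may both be 0; moving \<open>x0\<close>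
    by a multiple of \<open>q\<close> makes \<open>M\<close> positive without changing
    residues.\<close>
  define m where "m = \<bar>x0\<bar> + 1"
  define x where "x = x0 + int q * m"
  have m: "m > - x0" "m > 0" unfolding m_def by linarith+
  have "1 * m \<le> int q * m" using q m by (intro mult_right_mono) auto
  then have xpos: "x > 0" using m unfolding x_def by linarith
  have xx: "[x = x0] (mod int q)" by (simp add: x_def cong_iff_dvd_diff)
  define M where "M = nat (x\<^sup>2 + y\<^sup>2)"
  have M: "int M = x\<^sup>2 + y\<^sup>2" "M > 0" using xpos by (auto simp: M_def intro: add_pos_nonneg)
  have Mx: "[int M = x0\<^sup>2 + y\<^sup>2] (mod int q)"
    unfolding M(1) using xx by (intro cong_add cong_pow) auto
  have "coprime (int M) (int q)" using cong_imp_coprime[OF cong_sym[OF Mx] ln(1)] .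
  then have Mq: "coprime M q" by simp
  obtain S r E where S: "finite S" "\<forall>p\<in>S. prime p \<and> p mod 4 = 1 \<and> \<not> p dvd M" and r: "r \<in> S"
    and J: "J \<le> card (S - {r})" and S1: "[\<Prod>S = 1] (mod q)"
    and E: "\<forall>p\<in>S. E p > 0 \<and> int M dvd E p" "\<forall>p\<in>S. \<forall>p'\<in>S. p \<noteq> p' \<longrightarrow> int p dvd E p'"
      "\<forall>p\<in>S - {r}. int q dvd E p" "[E r = s2 - s1] (mod int q)" "inj_on E (S - {r})"
      "sum E (S - {r}) < E r" "sum E S < int (\<Prod>S)"
    using offsets_exist[OF q(1) M(2) Mq, where J = J and w = "s2 - s1"] by blast
  have pr: "prime p" "p mod 4 = 1" "\<not> p dvd M" if "p \<in> S" for p using S(2) that by auto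
  define Q where "Q = int (\<Prod>S)"
  have "\<Prod>S > 0" by (intro prod_pos) (metis pr(1) prime_gt_0_nat)
  then have Q0: "Q > 0" unfolding Q_def by (simp only: of_nat_0_less_iff)
  have Mpos: "int M > 0" using M(2) by simp
  have qpos: "int q > 0" using q(1) by simp
  define D where "D = int M * Q"
  have D0: "D > 0" using Mpos Q0 by (simp add: D_def)
  have MQ: "coprime (int M) Q"
    unfolding Q_def using S(1) pr by (intro coprime_prod_primes_int) auto
  have Qq1: "[Q = 1] (mod int q)" using S1 unfolding Q_def by (metis cong_int_iff of_nat_1)
  then have Qq: "coprime Q (int q)" by (metis cong_imp_coprime cong_sym coprime_1_left)
  have Mq': "coprime (int M) (int q)" using Mq by simp
  have "\<not> int p dvd 2" if "p \<in> S" for p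
  proof
    assume "int p dvd 2"
    then have "p \<le> 2" using zdvd_imp_le[of "int p" 2] by simp
    then have "p = 2" using prime_ge_2_nat[OF pr(1)[OF that]] by simp
    then show False using pr(2)[OF that] by simp
  qed
  then have "coprime 2 Q" unfolding Q_def using S(1) pr by (intro coprime_prod_primes_int) auto
  then obtain w where w: "[2 * w = 1] (mod Q)" using cong_solve_coprime_int by blast
  \<comment> \<open>Modulo \<open>Q\<close>, \<open>s0\<close> is minus half the sum of all offsets.
    As the other offsets vanish modulo \<open>p\<close>, this makes -s0 congruent to
    \<open>s0 + E p\<close> for every \<open>p\<close> in \<open>S\<close>.\<close>
  obtain s0 where s0: "s0 > 0" "[s0 = x] (mod int M)" "[s0 = - (sum E S) * w] (mod Q)" "[s0 = s1] (mod int q)"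
    using chinese_remainder_3_int[OF Mpos Q0 qpos MQ Mq' Qq] by blast
  have Qs0: "Q dvd 2 * s0 + sum E S"
  proof -
    have "[2 * s0 = 2 * (- (sum E S) * w)] (mod Q)" using s0(3) by (rule cong_scalar_left)
    also have "2 * (- (sum E S) * w) = - (sum E S) * (2 * w)" by simp
    also have "[- (sum E S) * (2 * w) = - (sum E S) * 1] (mod Q)" using w by (rule cong_scalar_left)
    finally show ?thesis by (simp add: cong_iff_dvd_diff)
  qed
  have ps0: "int p dvd 2 * s0 + E p" if p: "p \<in> S" for p
  proof -
    have "p dvd \<Prod>S" using S(1) p by (auto intro: dvd_prodI)
    then have "int p dvd Q" unfolding Q_def by (simp only: of_nat_dvd_iff)
    then have "int p dvd 2 * s0 + sum E S" using Qs0 by (rule dvd_trans)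
    moreover have "int p dvd sum E (S - {p})" using E(2) p by (intro dvd_sum) auto
    ultimately have "int p dvd (2 * s0 + sum E S) - sum E (S - {p})" by (rule dvd_diff)
    then show ?thesis using sum.remove[OF S(1) p, of E] by simp
  qed
  have prS: "\<forall>p\<in>S. prime p \<and> p mod 4 = 1" using pr by blast
  obtain i where i: "Q dvd i\<^sup>2 + 1" unfolding Q_def using sqrt_minus_one_prod_primes[OF S(1) prS] by blast
  \<comment> \<open>The class of \<open>T\<close>: \<open>y\<close> modulo \<open>M\<close> and
    \<open>i * s0\<close> modulo \<open>Q\<close> make \<open>D\<close> divide T^2 + s^2 at all
    subset sums, and \<open>T0\<close> modulo \<open>q\<close> fixes the residue classes.\<close>
  obtain c where c: "[c = y] (mod int M)" "[c = i * s0] (mod Q)" "[c = T0] (mod int q)"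
    using chinese_remainder_3_int[OF Mpos Q0 qpos MQ Mq' Qq] by blast
  define W where "W = M * \<Prod>S * q"
  have W: "int W = D * int q" by (simp only: W_def D_def Q_def of_nat_mult)
  have "int W > 0" unfolding W using D0 qpos by simp
  then have W0: "W > 0" by simp
  define sm where "sm = s0 + sum E S"
  \<comment> \<open>This range contains every D u - T^2 for \<open>u\<close> in the window and does
    not involve \<open>T\<close>, so \<open>T\<close> can be chosen afterwards.\<close>
  define G where "G = {\<Delta> \<in> {s0\<^sup>2..sm\<^sup>2}. \<not> (\<exists>z. \<Delta> = z\<^sup>2)}"
  have finG: "finite G" unfolding G_def by (rule finite_subset[of _ "{s0\<^sup>2..sm\<^sup>2}"]) auto
  have Gpos: "\<Delta> > 0 \<and> \<not> (\<exists>z. \<Delta> = z\<^sup>2)" if "\<Delta> \<in> G" for \<Delta>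
  proof -
    have "0 < s0\<^sup>2" using s0(1) by simp
    moreover have "s0\<^sup>2 \<le> \<Delta>" "\<not> (\<exists>z. \<Delta> = z\<^sup>2)" using that by (simp_all add: G_def)
    ultimately show ?thesis using less_le_trans by blast
  qed
  obtain W' c' where W': "W' > 0" "W dvd W'" "[c' = c] (mod int W)"
    and kill: "\<And>T \<Delta>. [T = c'] (mod int W') \<Longrightarrow> \<Delta> \<in> G \<Longrightarrow> \<exists>p. prime p \<and> p mod 4 = 3 \<and> \<not> p dvd W \<and>
      int p dvd T\<^sup>2 + \<Delta> \<and> \<not> (int p)\<^sup>2 dvd T\<^sup>2 + \<Delta>"
    using progression_avoiding_sums_of_two_squares[OF finG Gpos W0] by metis
  \<comment> \<open>The absolute value offsets a negative \<open>c'\<close>; the rest lifts T^2 to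
    at least D (N + 1), which puts the window beyond \<open>N\<close>.\<close>
  define k where "k = \<bar>c'\<bar> + D * (int N + 1)"
  define T where "T = c' + int W' * k"
  have TW': "[T = c'] (mod int W')" by (simp add: T_def cong_iff_dvd_diff)
  have Tbig: "T \<ge> D * (int N + 1)"
  proof -
    have k: "k \<ge> D * (int N + 1) - c'" "k \<ge> 0" using D0 by (simp_all add: k_def)
    have "1 * k \<le> int W' * k" using W'(1) k by (intro mult_right_mono) auto
    then show ?thesis using k unfolding T_def by linarith
  qed
  have DN: "D * (int N + 1) \<ge> 1" using mult_pos_pos[OF D0, of "int N + 1"] by linarith
  have TT: "T\<^sup>2 \<ge> D * (int N + 1)"
  proof -
    have "T * 1 \<le> T * T" using Tbig DN by (intro mult_left_mono) auto
    then show ?thesis using Tbig by (simp add: power2_eq_square)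
  qed
  have "[T = c'] (mod int W)" using cong_dvd_modulus[OF TW'] W'(2) by simp
  then have TW: "[T = c] (mod D * int q)" using W'(3) unfolding W by (rule cong_trans)
  have TM: "[T = y] (mod int M)" and TQ: "[T = i * s0] (mod Q)" and Tq: "[T = T0] (mod int q)"
    using c cong_trans[OF cong_dvd_modulus[OF TW]] by (auto simp: D_def)
  define s where "s I = s0 + sum E I" for I
  have finI: "finite I" if "I \<subseteq> S" for I using that S(1) by (rule finite_subset)
  have sM: "[s I = x] (mod int M)" if "I \<subseteq> S" for I
  proof -
    have "int M dvd sum E I" using E(1) that by (intro dvd_sum) auto
    then have "[s I = s0] (mod int M)" by (simp add: s_def cong_iff_dvd_diff)
    then show ?thesis using s0(2) by (rule cong_trans)
  qed
  have QT0: "Q dvd T\<^sup>2 + s0\<^sup>2"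
  proof -
    have "[T\<^sup>2 + s0\<^sup>2 = (i * s0)\<^sup>2 + s0\<^sup>2] (mod Q)" using TQ by (intro cong_add cong_pow) auto
    moreover have "(i * s0)\<^sup>2 + s0\<^sup>2 = (i\<^sup>2 + 1) * s0\<^sup>2" by (simp add: power2_eq_square algebra_simps)
    then have "Q dvd (i * s0)\<^sup>2 + s0\<^sup>2" using i by simp
    ultimately show ?thesis using cong_dvd_iff by blast
  qed
  have Ddvd: "D dvd T\<^sup>2 + (s I)\<^sup>2" if I: "I \<subseteq> S" for I
    unfolding D_def
  proof (rule divides_mult)
    have "[T\<^sup>2 + (s I)\<^sup>2 = y\<^sup>2 + x\<^sup>2] (mod int M)" using TM sM[OF I] by (intro cong_add cong_pow)
    moreover have "int M dvd y\<^sup>2 + x\<^sup>2" unfolding M(1) by (simp add: add.commute)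
    ultimately show "int M dvd T\<^sup>2 + (s I)\<^sup>2" using cong_dvd_iff by blast
    have "Q dvd (s I)\<^sup>2 - s0\<^sup>2" unfolding s_def Q_def
      using S(1) pr(1) E(2) ps0 I by (intro square_roots_of_subset_sum) auto
    then have "Q dvd (T\<^sup>2 + s0\<^sup>2) + ((s I)\<^sup>2 - s0\<^sup>2)" by (rule dvd_add[OF QT0])
    then show "Q dvd T\<^sup>2 + (s I)\<^sup>2" by simp
  qed (rule MQ)
  have "\<forall>I\<in>Pow S. \<exists>e\<in>sums_two_squares. T\<^sup>2 + (s I)\<^sup>2 = D * int e"
  proof
    fix I assume "I \<in> Pow S"
    then have I: "I \<subseteq> S" by simp
    show "\<exists>e\<in>sums_two_squares. T\<^sup>2 + (s I)\<^sup>2 = D * int e"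
      unfolding D_def Q_def
      using Ddvd[OF I] unfolding D_def Q_def
      by (intro sum_squares_div_composite[OF M(1) Mpos TM sM[OF I] S(1) prS])
  qed
  then obtain e where e: "\<And>I. I \<subseteq> S \<Longrightarrow> e I \<in> sums_two_squares \<and> T\<^sup>2 + (s I)\<^sup>2 = D * int (e I)"
    by (metis PowI)
  have smono: "s I \<le> s I'" if "I \<subseteq> I'" "I' \<subseteq> S" for I I'
    unfolding s_def using E(1) that finI[OF that(2)] by (auto intro!: sum_mono2 simp: less_imp_le)
  have spos: "s I > 0" if "I \<subseteq> S" for I
    using smono[of "{}" I] that s0(1) by (simp add: s_def)
  have ele: "e I \<le> e I' \<longleftrightarrow> s I \<le> s I'" if "I \<subseteq> S" "I' \<subseteq> S" for I I'
  proof -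
    have "e I \<le> e I' \<longleftrightarrow> D * int (e I) \<le> D * int (e I')" using D0 by simp
    also have "\<dots> \<longleftrightarrow> (s I)\<^sup>2 \<le> (s I')\<^sup>2" using e[OF that(1)] e[OF that(2)] by auto
    also have "\<dots> \<longleftrightarrow> s I \<le> s I'" using spos[OF that(1)] spos[OF that(2)]
      by (simp add: power_mono_iff)
    finally show ?thesis .
  qed
  \<comment> \<open>D e(I) = T0^2 + t^2 = z (x0^2 + y^2) = z M = z D modulo \<open>q\<close>, the
    last because \<open>Q\<close> is 1 modulo \<open>q\<close>; \<open>D\<close> is coprime to
    \<open>q\<close> and cancels.\<close>
  have residue: "[int (e I) = (if r \<in> I then b else a)] (mod int q)" if I: "I \<subseteq> S" for I
  proof -
    define z where "z = (if r \<in> I then b else a)"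
    define t where "t = (if r \<in> I then s2 else s1)"
    have "[s I = t] (mod int q)"
    proof (cases "r \<in> I")
      case True
      have "int q dvd sum E (I - {r})" using E(3) I by (intro dvd_sum) auto
      then have "[sum E (I - {r}) = 0] (mod int q)" by (simp add: cong_0_iff)
      then have "[s0 + (E r + sum E (I - {r})) = s1 + ((s2 - s1) + 0)] (mod int q)"
        using s0(4) E(4) by (intro cong_add)
      then show ?thesis using True sum.remove[OF finI[OF I] True, of E] by (simp add: s_def t_def)
    next
      case False
      have "int q dvd sum E I" using E(3) I False by (intro dvd_sum) auto
      then have "[sum E I = 0] (mod int q)" by (simp add: cong_0_iff)
      then have "[s0 + sum E I = s1 + 0] (mod int q)" using s0(4) by (intro cong_add)
      then show ?thesis using False by (simp add: s_def t_def)
    qed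
    then have "[T\<^sup>2 + (s I)\<^sup>2 = T0\<^sup>2 + t\<^sup>2] (mod int q)" using Tq by (intro cong_add cong_pow)
    moreover have "[T0\<^sup>2 + t\<^sup>2 = z * (x0\<^sup>2 + y\<^sup>2)] (mod int q)" using ln(2,3) by (simp add: z_def t_def)
    moreover have "[z * (x0\<^sup>2 + y\<^sup>2) = z * int M] (mod int q)" using Mx by (intro cong_scalar_left) (rule cong_sym)
    moreover have "[z * int M * 1 = z * int M * Q] (mod int q)" using Qq1 by (intro cong_scalar_left) (rule cong_sym)
    ultimately have "[T\<^sup>2 + (s I)\<^sup>2 = z * int M * Q] (mod int q)" by (metis cong_trans mult_1_right)
    then have "[D * int (e I) = D * z] (mod int q)" using e[OF I] by (simp add: D_def mult_ac)
    moreover have "coprime D (int q)" using Mq' Qq by (simp add: D_def)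
    ultimately show ?thesis unfolding z_def by (simp add: cong_mult_lcancel)
  qed
  \<comment> \<open>If D u - T^2 is not a square, a prime from \<open>kill\<close> divides
    \<open>u\<close> exactly once. If it is a square t^2, then \<open>t\<close> is a root of t^2 =
    s0^2 modulo \<open>Q\<close> in the range of the subset sums.\<close>
  have all: "\<exists>I\<subseteq>S. u = e I" if u: "u \<in> sums_two_squares" "e {} \<le> u" "u \<le> e S" for u
  proof -
    define \<Delta> where "\<Delta> = D * int u - T\<^sup>2"
    have "D * int (e {}) \<le> D * int u" "D * int u \<le> D * int (e S)" using u D0 by simp_all
    then have range: "s0\<^sup>2 \<le> \<Delta>" "\<Delta> \<le> sm\<^sup>2"
      using e[of "{}"] e[of S] by (auto simp: \<Delta>_def s_def sm_def)
    have Tu: "T\<^sup>2 + \<Delta> = D * int u" by (simp add: \<Delta>_def)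
    have "\<exists>z. \<Delta> = z\<^sup>2"
    proof (rule ccontr)
      assume "\<not> ?thesis"
      then have "\<Delta> \<in> G" using range by (simp add: G_def)
      from kill[OF TW' this] obtain p where p: "prime p" "p mod 4 = 3" "\<not> p dvd W" "int p dvd D * int u" "\<not> (int p)\<^sup>2 dvd D * int u"
        unfolding Tu by blast
      have "\<not> int p dvd D"
      proof
        assume "int p dvd D"
        then have "int p dvd int W" unfolding W by simp
        then show False using p(3) by simp
      qed
      then have "int p dvd int u" using p(1,4) by (simp add: prime_dvd_mult_iff)
      then have "p dvd u" by simp
      moreover have "\<not> p\<^sup>2 dvd u"
      proof
        assume "p\<^sup>2 dvd u"
        then have "int (p\<^sup>2) dvd int u" by (simp only: of_nat_dvd_iff)
        then show False using p(5) by simp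
      qed
      ultimately show False using not_sum_of_two_squares[OF p(1,2)] u(1) by blast
    qed
    then obtain z where z: "\<Delta> = z\<^sup>2" by blast
    define t where "t = \<bar>z\<bar>"
    have t: "t \<ge> 0" "\<Delta> = t\<^sup>2" using z by (simp_all add: t_def)
    have "sm > 0" using spos[of S] by (simp add: s_def sm_def)
    then have t2: "s0 \<le> t" "t \<le> sm"
      using range t power2_le_imp_le[of s0 t] power2_le_imp_le[of t sm] by auto
    have "Q dvd T\<^sup>2 + t\<^sup>2" using Tu t(2) by (simp add: D_def)
    then have "Q dvd (T\<^sup>2 + t\<^sup>2) - (T\<^sup>2 + s0\<^sup>2)" using QT0 by (rule dvd_diff)
    then have Qt: "Q dvd t\<^sup>2 - s0\<^sup>2" by simp
    have "t < s0 + Q" using t2(2) E(7) unfolding sm_def Q_def by linarith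
    then have "\<exists>I\<subseteq>S. t = s0 + sum E I"
      using Qt t2 S(1) pr(1) E ps0 unfolding Q_def
      by (intro square_root_eq_subset_sum) (auto simp: less_imp_le)
    then obtain I where I: "I \<subseteq> S" "t = s I" by (auto simp: s_def)
    then have "D * int u = D * int (e I)" using Tu t(2) e[OF I(1)] by metis
    then show ?thesis using D0 I(1) by auto
  qed
  define P where "P = S - {r}"
  have P: "P \<subseteq> S" by (auto simp: P_def)
  have sP: "s P < s {r}" using E(6) by (simp add: s_def P_def)
  show ?thesis
  proof (intro exI conjI ballI impI)
    have "D * (int N + 1) \<le> D * int (e {})"
      using TT e[OF empty_subsetI] zero_le_power2[of "s {}"] by linarith
    then show "N < e {}" using D0 by simp
  next
    fix u assume u: "u \<in> sums_two_squares" "e {} \<le> u" "u \<le> e P"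
    have "e P \<le> e S" using ele[OF P order_refl] smono[OF P] by simp
    then obtain I where I: "I \<subseteq> S" "u = e I" using all[of u] u by auto
    have "r \<notin> I"
    proof
      assume "r \<in> I"
      then have "s {r} \<le> s I" using smono I(1) by simp
      moreover have "s I \<le> s P" using u(3) ele[OF I(1) P] I(2) by simp
      ultimately show False using sP by simp
    qed
    then show "[int u = a] (mod int q)" using residue[OF I(1)] I(2) by simp
  next
    fix u assume u: "u \<in> sums_two_squares" "e P < u" "u \<le> e S"
    have "e {} \<le> e P" using ele[of "{}" P] smono[of "{}" P] P by simp
    then obtain I where I: "I \<subseteq> S" "u = e I" using all[of u] u by auto
    have "r \<in> I"
    proof (rule ccontr)
      assume "r \<notin> I"
      then have "s I \<le> s P" using I(1) P by (intro smono) (auto simp: P_def)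
      then show False using u(2) ele[OF I(1) P] I(2) by simp
    qed
    then show "[int u = b] (mod int q)" using residue[OF I(1)] I(2) by simp
  next
    \<comment> \<open>The singletons \<open>{p}\<close> with \<open>p\<close> in \<open>P\<close>
      supply the \<open>J\<close> values for the class \<open>a\<close>; the sets
      \<open>{r, p}\<close> do the same for \<open>b\<close> below.\<close>
    have "inj_on (\<lambda>p. e {p}) P"
    proof (rule inj_onI)
      fix p p' assume p: "p \<in> P" "p' \<in> P" "e {p} = e {p'}"
      have sub: "{p} \<subseteq> S" "{p'} \<subseteq> S" using p P by auto
      have "s {p} = s {p'}" using ele[OF sub] ele[OF sub(2,1)] p(3) by simp
      then show "p = p'" using E(5) p by (auto simp: s_def P_def inj_on_def)
    qed
    then have "card P = card ((\<lambda>p. e {p}) ` P)" by (simp add: card_image)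
    also have "\<dots> \<le> card {u \<in> sums_two_squares. e {} \<le> u \<and> u \<le> e P}"
    proof (rule card_mono)
      show "finite {u \<in> sums_two_squares. e {} \<le> u \<and> u \<le> e P}"
        by (rule finite_subset[of _ "{..e P}"]) auto
      show "(\<lambda>p. e {p}) ` P \<subseteq> {u \<in> sums_two_squares. e {} \<le> u \<and> u \<le> e P}"
      proof clarify
        fix p assume p: "p \<in> P"
        then have pS: "{p} \<subseteq> S" "{p} \<subseteq> P" using P by auto
        show "e {p} \<in> sums_two_squares \<and> e {} \<le> e {p} \<and> e {p} \<le> e P"
          using e[OF pS(1)] ele[of "{}" "{p}"] ele[OF pS(1) P] smono[of "{}" "{p}"] smono[OF pS(2) P] pS(1)
          by simp
      qed
    qed
    finally show "J \<le> card {u \<in> sums_two_squares. e {} \<le> u \<and> u \<le> e P}" using J by (simp add: P_def)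
  next
    have rP: "insert r {p} \<subseteq> S" if "p \<in> P" for p using that P r by auto
    have "inj_on (\<lambda>p. e {r, p}) P"
    proof (rule inj_onI)
      fix p p' assume p: "p \<in> P" "p' \<in> P" "e {r, p} = e {r, p'}"
      have "s {r, p} = s {r, p'}"
        using ele[OF rP[OF p(1)] rP[OF p(2)]] ele[OF rP[OF p(2)] rP[OF p(1)]] p(3) by simp
      moreover have "p \<noteq> r" "p' \<noteq> r" using p by (auto simp: P_def)
      ultimately have "E p = E p'" by (simp add: s_def)
      then show "p = p'" using E(5) p by (auto simp: P_def inj_on_def)
    qed
    then have "card P = card ((\<lambda>p. e {r, p}) ` P)" by (simp add: card_image)
    also have "\<dots> \<le> card {u \<in> sums_two_squares. e P < u \<and> u \<le> e S}"
    proof (rule card_mono)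
      show "finite {u \<in> sums_two_squares. e P < u \<and> u \<le> e S}"
        by (rule finite_subset[of _ "{..e S}"]) auto
      show "(\<lambda>p. e {r, p}) ` P \<subseteq> {u \<in> sums_two_squares. e P < u \<and> u \<le> e S}"
      proof clarify
        fix p assume p: "p \<in> P"
        have "s {r} \<le> s {r, p}" using smono[of "{r}" "{r, p}"] rP[OF p] by simp
        then have "\<not> e {r, p} \<le> e P" using ele[OF rP[OF p] P] sP by simp
        then show "e {r, p} \<in> sums_two_squares \<and> e P < e {r, p} \<and> e {r, p} \<le> e S"
          using e[OF rP[OF p]] ele[OF rP[OF p] order_refl] smono[OF rP[OF p] order_refl] by simp
      qed
    qed
    finally show "J \<le> card {u \<in> sums_two_squares. e P < u \<and> u \<le> e S}" using J by (simp add: P_def)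
  qed
qed

section \<open>From windows to consecutive elements\<close>

text \<open>\<open>n0\<close> is the index of the last element up to \<open>mid\<close>. At least
  \<open>J\<close> elements lie on either side, so moving fewer than \<open>J\<close> places down or
  at most \<open>J\<close> places up stays in the window. The bound \<open>J \<le> n0 + 1\<close>
  keeps \<open>n0 - i\<close> from being truncated.\<close>

lemma enumerate_window:
  fixes A :: "nat set"
  assumes A: "infinite A"
    and lower: "J \<le> card {e \<in> A. lo \<le> e \<and> e \<le> mid}" and upper: "J \<le> card {e \<in> A. mid < e \<and> e \<le> hi}"
    and J: "J > 0"
  shows "\<exists>n0. J \<le> n0 + 1 \<and>
    (\<forall>i<J. lo \<le> enumerate A (n0 - i) \<and> enumerate A (n0 - i) \<le> mid) \<and>
    (\<forall>i. 0 < i \<longrightarrow> i \<le> J \<longrightarrow> mid < enumerate A (n0 + i) \<and> enumerate A (n0 + i) \<le> hi)"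
proof -
  let ?en = "enumerate A"
  define L where "L = {e \<in> A. lo \<le> e \<and> e \<le> mid}"
  define U where "U = {e \<in> A. mid < e \<and> e \<le> hi}"
  have finL: "finite L" by (rule finite_subset[of _ "{..mid}"]) (auto simp: L_def)
  have "card L > 0" using lower J by (simp add: L_def)
  then have "L \<noteq> {}" by auto
  then have mx: "Max L \<in> L" using finL by simp
  then obtain n0 where n0: "?en n0 = Max L" using enumerate_Ex[of A "Max L"] A by (auto simp: L_def)
  have le_iff: "?en k \<le> ?en m \<longleftrightarrow> k \<le> m" for k m
    using A by (metis enumerate_mono linorder_not_le order_le_less)
  have inA: "?en k \<in> A" for k using A by (rule enumerate_in_set)
  have low: "n0 + 1 \<ge> J"
  proof -
    have "L \<subseteq> ?en ` {..n0}"
    proof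
      fix e assume e: "e \<in> L"
      then obtain k where k: "?en k = e" using enumerate_Ex[of A e] A by (auto simp: L_def)
      have "e \<le> Max L" using e finL by simp
      then show "e \<in> ?en ` {..n0}" using k n0 le_iff[of k n0] by auto
    qed
    then have "card L \<le> card {..n0}" using surj_card_le[of "{..n0}" L ?en] by simp
    then show ?thesis using lower by (simp add: L_def)
  qed
  have 1: "lo \<le> ?en (n0 - i) \<and> ?en (n0 - i) \<le> mid" if i: "i < J" for i
  proof
    have "?en (n0 - i) \<le> ?en n0" using le_iff by simp
    also have "\<dots> \<le> mid" using mx n0 by (simp add: L_def)
    finally show "?en (n0 - i) \<le> mid" .
    show "lo \<le> ?en (n0 - i)"
    proof (rule ccontr)
      assume h: "\<not> lo \<le> ?en (n0 - i)"
      have "L \<subseteq> ?en ` {n0 - i<..n0}"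
      proof
        fix e assume e: "e \<in> L"
        then obtain k where k: "?en k = e" using enumerate_Ex[of A e] A by (auto simp: L_def)
        have "e \<le> Max L" using e finL by simp
        then have "k \<le> n0" using k n0 le_iff[of k n0] by auto
        moreover have "\<not> k \<le> n0 - i"
        proof
          assume "k \<le> n0 - i"
          then have "?en k \<le> ?en (n0 - i)" using le_iff by simp
          then show False using h k e by (simp add: L_def)
        qed
        ultimately show "e \<in> ?en ` {n0 - i<..n0}" using k by auto
      qed
      then have "card L \<le> card {n0 - i<..n0}" using surj_card_le[of "{n0 - i<..n0}" L ?en] by simp
      also have "\<dots> \<le> i" by simp
      finally show False using lower i by (simp add: L_def)
    qed
  qed
  have 2: "mid < ?en (n0 + i) \<and> ?en (n0 + i) \<le> hi" if i: "0 < i" "i \<le> J" for i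
  proof
    show "mid < ?en (n0 + i)"
    proof (rule ccontr)
      assume h: "\<not> mid < ?en (n0 + i)"
      have "\<not> ?en (n0 + i) \<le> ?en n0" using le_iff i by simp
      moreover have "lo \<le> ?en n0" using mx n0 by (simp add: L_def)
      ultimately have "?en (n0 + i) \<in> L" using h inA by (simp add: L_def)
      then have "?en (n0 + i) \<le> Max L" using finL by simp
      then show False using \<open>\<not> ?en (n0 + i) \<le> ?en n0\<close> n0 by simp
    qed
    show "?en (n0 + i) \<le> hi"
    proof (rule ccontr)
      assume h: "\<not> ?en (n0 + i) \<le> hi"
      have "U \<subseteq> ?en ` {n0<..<n0 + i}"
      proof
        fix e assume e: "e \<in> U"
        then obtain k where k: "?en k = e" using enumerate_Ex[of A e] A by (auto simp: U_def)
        have "\<not> k \<le> n0"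
        proof
          assume "k \<le> n0"
          then have "e \<le> Max L" using le_iff k n0 by metis
          then show False using e mx by (simp add: U_def L_def)
        qed
        moreover have "\<not> n0 + i \<le> k"
        proof
          assume "n0 + i \<le> k"
          then have "?en (n0 + i) \<le> ?en k" using le_iff by simp
          then show False using h k e by (simp add: U_def)
        qed
        ultimately show "e \<in> ?en ` {n0<..<n0 + i}" using k by auto
      qed
      then have "card U \<le> card {n0<..<n0 + i}" using surj_card_le[of "{n0<..<n0 + i}" U ?en] by simp
      also have "\<dots> = i - 1" by simp
      finally show False using upper i by (simp add: U_def)
    qed
  qed
  show ?thesis using low 1 2 by (intro exI[of _ n0]) auto
qed

theorem theorem1p1:
  fixes q r j :: nat and a b :: int and as :: "int list"
  assumes "q \<ge> 1" and "odd q"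
    and "admissible q a" and "admissible q b"
    and "r \<ge> 1" and "length as = r"
    and "1 \<le> j" and "j \<le> r"
    and "\<And>i. 1 \<le> i \<Longrightarrow> i \<le> j \<Longrightarrow> [as ! (i - 1) = a] (mod int q)"
    and "\<And>i. j < i \<Longrightarrow> i \<le> r \<Longrightarrow> [as ! (i - 1) = b] (mod int q)"
  shows "filterlim (\<lambda>x::real. N_count x q as) at_top at_top"
proof -
  define Pat where "Pat n \<longleftrightarrow> (\<forall>i\<in>{1..length as}. [int (E_seq (n + i - 1)) = as ! (i - 1)] (mod int q))" for n
  define H where "H = {E_seq n | n. n \<ge> 1 \<and> Pat n}"
  \<comment> \<open>Matching positions beyond every bound make \<open>H\<close> infinite, which is
    all that divergence of the count requires.\<close>
  have unb: "\<exists>e\<in>H. N < e" for N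
  proof -
    have "q > 0" using assms(1) by simp
    from two_class_window[OF this assms(2-4), where N = N and J = r] obtain lo mid hi where w: "N < lo"
      "\<forall>e\<in>sums_two_squares. lo \<le> e \<longrightarrow> e \<le> mid \<longrightarrow> [int e = a] (mod int q)"
      "\<forall>e\<in>sums_two_squares. mid < e \<longrightarrow> e \<le> hi \<longrightarrow> [int e = b] (mod int q)"
      "r \<le> card {e \<in> sums_two_squares. lo \<le> e \<and> e \<le> mid}"
      "r \<le> card {e \<in> sums_two_squares. mid < e \<and> e \<le> hi}" by blast
    have "r > 0" using assms(5) by simp
    from enumerate_window[OF infinite_sums_two_squares w(4,5) this] obtain n0 where n0: "r \<le> n0 + 1"
      "\<forall>i<r. lo \<le> enumerate sums_two_squares (n0 - i) \<and> enumerate sums_two_squares (n0 - i) \<le> mid"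
      "\<forall>i. 0 < i \<longrightarrow> i \<le> r \<longrightarrow> mid < enumerate sums_two_squares (n0 + i) \<and> enumerate sums_two_squares (n0 + i) \<le> hi"
      by blast
    have inS: "enumerate sums_two_squares k \<in> sums_two_squares" for k
      by (rule enumerate_in_set[OF infinite_sums_two_squares])
    \<comment> \<open>\<open>E_seq\<close> counts from 1 and \<open>enumerate\<close> from 0; with
      this \<open>n\<close> the entry \<open>j\<close> of the tuple falls on index
      \<open>n0\<close>, the last one in the class \<open>a\<close>.\<close>
    define n where "n = n0 + 2 - j"
    have n1: "n \<ge> 1" using n0(1) assms(8) by (simp add: n_def)
    have "Pat n"
      unfolding Pat_def
    proof
      fix i assume "i \<in> {1..length as}"
      then have i: "1 \<le> i" "i \<le> r" using assms(6) by auto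
      show "[int (E_seq (n + i - 1)) = as ! (i - 1)] (mod int q)"
      proof (cases "i \<le> j")
        case True
        have "n + i - 1 - 1 = n0 - (j - i)" using True i n0(1) assms(8) by (simp add: n_def)
        moreover have "j - i < r" using i assms(8) by simp
        ultimately have "[int (E_seq (n + i - 1)) = a] (mod int q)"
          unfolding E_seq_def using n0(2)[rule_format, of "j - i"] w(2) inS by simp
        moreover have "[a = as ! (i - 1)] (mod int q)" using assms(9)[OF i(1) True] by (rule cong_sym)
        ultimately show ?thesis by (rule cong_trans)
      next
        case False
        have "n + i - 1 - 1 = n0 + (i - j)" using False n0(1) assms(7,8) by (simp add: n_def)
        moreover have "0 < i - j" "i - j \<le> r" using False i by simp_all
        ultimately have "[int (E_seq (n + i - 1)) = b] (mod int q)"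
          unfolding E_seq_def using n0(3)[rule_format, of "i - j"] w(3) inS by simp
        moreover have "[b = as ! (i - 1)] (mod int q)"
          by (rule cong_sym, rule assms(10)) (use False i in simp_all)
        ultimately show ?thesis by (rule cong_trans)
      qed
    qed
    then have "E_seq n \<in> H" using n1 by (auto simp: H_def)
    moreover have "N < E_seq n"
    proof -
      have "n - 1 = n0 - (j - 1)" using assms(7) n0(1) assms(8) by (simp add: n_def)
      moreover have "j - 1 < r" using assms(7,8) by simp
      ultimately show ?thesis unfolding E_seq_def using n0(2)[rule_format, of "j - 1"] w(1) by simp
    qed
    ultimately show ?thesis by blast
  qed
  then have "infinite H" by (auto simp: infinite_nat_iff_unbounded)
  have count: "N_count x q as = card {e \<in> H. real e \<le> x}" for x
  proof -
    have "{E_seq n | n. n \<ge> 1 \<and> real (E_seq n) \<le> x \<and> Pat n} = {e \<in> H. real e \<le> x}"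
      by (auto simp: H_def)
    then show ?thesis by (simp add: N_count_def Pat_def)
  qed
  show ?thesis
    unfolding filterlim_at_top
  proof
    fix Z :: nat
    obtain B where B: "finite B" "card B = Z" "B \<subseteq> H"
      using infinite_arbitrarily_large[OF \<open>infinite H\<close>] by blast
    obtain m where m: "\<forall>e\<in>B. e \<le> m" using B(1) finite_nat_set_iff_bounded_le by auto
    have "Z \<le> N_count x q as" if "x \<ge> real m" for x
    proof -
      have "{e \<in> H. real e \<le> x} \<subseteq> {..nat \<lfloor>x\<rfloor>}" by (auto simp: le_nat_floor)
      then have "finite {e \<in> H. real e \<le> x}" by (rule finite_subset) simp
      moreover have "B \<subseteq> {e \<in> H. real e \<le> x}" using B(3) m that by (auto intro: order_trans[of _ "real m"])
      ultimately have "card B \<le> card {e \<in> H. real e \<le> x}" by (rule card_mono)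
      then show ?thesis using B(2) count by simp
    qed
    then show "\<forall>\<^sub>F x in at_top. Z \<le> N_count x q as"
      unfolding eventually_at_top_linorder by blast
  qed
qed

end
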